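(* Let $p \geq 2$. Let $n \geq 1$ be an integer, let $x_1, \dots, x_n$ be real numbers, let $\mathcal{E}_1, \dots, \mathcal{E}_n$ be i.i.d. standard exponential random variables, and set $X = \sum_{j=1}^n x_j \mathcal{E}_j$. Then $$\|X\|_p \geq \|G\|_p \sqrt{\operatorname{Var}(X)},$$ where $G \sim N(0,1)$ is a standard Gaussian random variable.
   Context: A standard exponential random variable has density $e^{-x}\mathbf{1}_{[0,+\infty)}(x)$ on $\mathbb{R}$ (mean $1$, variance $1$). For a random variable $X$, $\|X\|_p = (\mathbb{E}|X|^p)^{1/p}$. *)

theory Defs
  imports "HOL-Probability.Probability"
begin

(* The Bochner integral is 0 on non-integrable functions, so this agrees with the usual L^p norm
   only for random variables with a finite p-th absolute moment. Finite linear combinations of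
   exponential variables, and Gaussian variables, have all such moments. *)
definition Lp_norm :: "'a measure \<Rightarrow> real \<Rightarrow> ('a \<Rightarrow> real) \<Rightarrow> real" where
  "Lp_norm M p X = (\<integral>\<omega>. \<bar>X \<omega>\<bar> powr p \<partial>M) powr (1 / p)"

end

theory Submission
  imports Defs
begin

text \<open>
  The argument is a real-exponent version of Hunter's proof of the positivity of the complete
  homogeneous symmetric polynomials. Write \<open>F\<^sub>p(x) = E|\<Sum> x\<^sub>i E\<^sub>i|\<^sup>p\<close> and \<open>g\<^sub>p = E|G|\<^sup>p\<close>, so that
  \<open>g\<^sub>p = (p - 1) g\<^sub>p\<^sub>-\<^sub>2\<close>, and let \<open>x\<close> minimise \<open>F\<^sub>p\<close> on the unit sphere. Integration by parts against
  the exponential density and the size-bias identity \<open>E[E\<^sub>i f(X)] = E f(X + x\<^sub>i E')\<close> turn the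
  Lagrange conditions for two coordinates \<open>x\<^sub>i \<noteq> x\<^sub>j\<close> into
  \<open>F\<^sub>p(x) = (p - 1) E|X + x\<^sub>i E' + x\<^sub>j E''|\<^sup>p\<^sup>-\<^sup>2\<close>, which reduces exponent \<open>p \<ge> 4\<close> to \<open>p - 2\<close>.
  For \<open>2 < p < 4\<close> the remaining exponent \<open>q = p - 2\<close> lies in \<open>(0, 2)\<close>, where the inequality itself
  fails in general; choosing \<open>|x\<^sub>i|\<close> maximal, the surplus variance \<open>x\<^sub>i\<^sup>2\<close> compensates. This is seen from
  \<open>|z|\<^sup>q = C \<integral> (1 - cos (t z)) t\<^sup>-\<^sup>1\<^sup>-\<^sup>q dt\<close> and a comparison of the characteristic function with that
  of a Gaussian whose variance is Gamma distributed. If all \<open>x\<^sub>i\<close> are equal, a direct estimate suffices.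
\<close>

section \<open>Linear combinations of independent exponential variables\<close>

text \<open>For an integer \<open>d\<close>, \<open>E X^d = d! h_d(x)\<close> with
  \<open>h_d\<close> the complete homogeneous symmetric polynomial. In this dictionary integration
  by parts is \<open>h_d(x, t) = h_d(x) + t h_{d-1}(x, t)\<close>, and the size-bias identity is
  \<open>dh_d/dx_i = h_{d-1}(x, x_i)\<close> with the variable \<open>x_i\<close> repeated. Both
  survive for real exponents, with \<open>|z|^p\<close> and \<open>z |z|^(p-2)\<close> in place of
  monomials; the induction thus adds coordinates to the vector and never expands a power. The
  obstacle is a reduced exponent \<open>q < 2\<close>: \<open>(E_1 - E_2) / sqrt 2\<close> has
  variance 1 and first absolute moment 0.707..., below \<open>E|G| = 0.797...\<close>. There the
  enlarged vector itself has to be used: its squares sum to at least \<open>1 + a\<close> and none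
  exceeds \<open>a = max x_i^2\<close>. The resulting bound on its characteristic function is that
  of a Gamma mixture of Gaussians with shape \<open>k = (1/a + 1)/2\<close>, and
  \<open>2a (k - 1/2) = 1\<close> makes the surplus \<open>a\<close> exactly the 1/2 that the Gamma
  function inequality costs.\<close>

abbreviation expD :: "real measure" where
  "expD \<equiv> density lborel (exponential_density 1)"

definition poly_growth :: "(real \<Rightarrow> real) \<Rightarrow> bool" where
  "poly_growth f \<longleftrightarrow> (\<exists>C k. \<forall>z. \<bar>f z\<bar> \<le> C * (1 + \<bar>z\<bar>) ^ k)"

text \<open>The index set varies because the argument passes from \<open>X\<close> to
  \<open>X + x_i E'\<close>: this becomes the insertion of a fresh index \<open>k\<close> together
  with \<open>fun_upd x k (x i)\<close>.\<close>

definition esum :: "nat set \<Rightarrow> (nat \<Rightarrow> real) \<Rightarrow> (real \<Rightarrow> real) \<Rightarrow> real" where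
  "esum I x f = (\<integral>\<omega>. f (\<Sum>i\<in>I. x i * \<omega> i) \<partial>Pi\<^sub>M I (\<lambda>_. expD))"

interpretation expD: prob_space expD
  by (rule prob_space_exponential_density) simp

interpretation expPi: product_sigma_finite "\<lambda>_::nat. expD"
  by unfold_locales

lemma poly_growthI: "(\<And>z. \<bar>f z\<bar> \<le> C * (1 + \<bar>z\<bar>) ^ k) \<Longrightarrow> poly_growth f"
  unfolding poly_growth_def by blast

lemma poly_growthE:
  assumes "poly_growth f"
  obtains C k where "C \<ge> 0" "\<And>z. \<bar>f z\<bar> \<le> C * (1 + \<bar>z\<bar>) ^ k"
proof -
  obtain C k where C: "\<And>z. \<bar>f z\<bar> \<le> C * (1 + \<bar>z\<bar>) ^ k"
    using assms unfolding poly_growth_def by blast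
  have "0 \<le> \<bar>f 0\<bar>" by simp
  also have "\<dots> \<le> C" using C[of 0] by simp
  finally show thesis using C that by blast
qed

section \<open>Domination and passage to the limit\<close>

lemma integrable_expD_exp_half: "integrable expD (\<lambda>u. exp (\<bar>u\<bar> / 2))"
proof -
  have *: "(\<lambda>u. exponential_density 1 u *\<^sub>R exp (\<bar>u\<bar> / 2)) = (\<lambda>u. 2 * exponential_density (1/2) u)"
    by (auto simp: exponential_density_def fun_eq_iff mult_exp_exp field_simps)
  have "integrable lborel (exponential_density (1/2))"
    using prob_space.emeasure_space_1[OF prob_space_exponential_density[of "1/2"]]
    by (intro integrableI_nonneg) (auto simp: emeasure_density)
  then show ?thesis
    by (subst integrable_density) (auto simp only: *, auto)
qed

lemma power_le_exp_half: "\<exists>C\<ge>0. \<forall>s\<ge>0. (1 + s) ^ k \<le> C * exp (s / 2 :: real)"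
proof (intro exI conjI allI impI)
  \<comment> \<open>The \<open>k\<close>-th power of \<open>1 + s <= c * exp (s / c)\<close> has
    exponent \<open>k * s / c\<close>; this \<open>c\<close> keeps \<open>k / c\<close> below 1/2
    and is at least 1 also for \<open>k = 0\<close>.\<close>
  let ?c = "2 * real k + 1"
  show "?c ^ k \<ge> 0" by simp
  fix s :: real assume s: "0 \<le> s"
  have "1 + s \<le> ?c * (1 + s / ?c)" using s by (simp add: field_simps)
  also have "\<dots> \<le> ?c * exp (s / ?c)" by (intro mult_left_mono) auto
  finally have "(1 + s) ^ k \<le> (?c * exp (s / ?c)) ^ k" using s by (intro power_mono) auto
  also have "\<dots> = ?c ^ k * exp (real k * (s / ?c))" by (simp add: power_mult_distrib exp_of_nat_mult del: times_divide_eq_right)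
  also have "\<dots> \<le> ?c ^ k * exp (s / 2)"
    using s by (intro mult_left_mono) (auto simp: field_simps)
  finally show "(1 + s) ^ k \<le> ?c ^ k * exp (s / 2)" .
qed

text \<open>The bound is uniform for coefficients in a box, as convergent sequences of coefficients
  require, and it is a product, so it is integrable coordinate by coordinate. The extra factor
  \<open>1 + (sum of |\<omega> i|)\<close> leaves room for a weight that is linear in the
  coordinates.\<close>

lemma poly_growth_dominated:
  assumes "poly_growth f" "finite (I :: nat set)"
  obtains C where "C \<ge> 0" "\<And>x \<omega>. (\<And>i. i \<in> I \<Longrightarrow> \<bar>x i\<bar> \<le> B) \<Longrightarrow>
     (1 + (\<Sum>i\<in>I. \<bar>\<omega> i\<bar>)) * \<bar>f (\<Sum>i\<in>I. x i * \<omega> i)\<bar> \<le> C * (\<Prod>i\<in>I. exp (\<bar>\<omega> i\<bar> / 2))"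
proof -
  obtain C k where C: "C \<ge> 0" "\<And>z. \<bar>f z\<bar> \<le> C * (1 + \<bar>z\<bar>) ^ k" using assms poly_growthE by blast
  obtain D where D: "D \<ge> 0" "\<And>s. s \<ge> 0 \<Longrightarrow> (1 + s) ^ Suc k \<le> D * exp (s / 2 :: real)"
    using power_le_exp_half[of "Suc k"] by blast
  let ?B = "1 + \<bar>B\<bar>"
  show thesis
  proof (rule that[of "C * ?B ^ k * D"])
    show "C * ?B ^ k * D \<ge> 0" using C D by simp
    fix x \<omega> :: "nat \<Rightarrow> real" assume x: "\<And>i. i \<in> I \<Longrightarrow> \<bar>x i\<bar> \<le> B"
    define s where "s = (\<Sum>i\<in>I. \<bar>\<omega> i\<bar>)"
    have s: "s \<ge> 0" unfolding s_def by (simp add: sum_nonneg)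
    have "\<bar>\<Sum>i\<in>I. x i * \<omega> i\<bar> \<le> (\<Sum>i\<in>I. \<bar>x i * \<omega> i\<bar>)" by (rule sum_abs)
    also have "\<dots> \<le> (\<Sum>i\<in>I. \<bar>B\<bar> * \<bar>\<omega> i\<bar>)"
      unfolding abs_mult using x by (intro sum_mono mult_right_mono) force+
    also have "\<dots> = \<bar>B\<bar> * s" by (simp add: s_def sum_distrib_left)
    finally have "1 + \<bar>\<Sum>i\<in>I. x i * \<omega> i\<bar> \<le> ?B * (1 + s)"
      using s by (simp add: algebra_simps)
    then have "(1 + \<bar>\<Sum>i\<in>I. x i * \<omega> i\<bar>) ^ k \<le> (?B * (1 + s)) ^ k"
      by (intro power_mono) auto
    then have "\<bar>f (\<Sum>i\<in>I. x i * \<omega> i)\<bar> \<le> C * (?B * (1 + s)) ^ k"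
      using C(2)[of "\<Sum>i\<in>I. x i * \<omega> i"] C(1) mult_left_mono by (meson order_trans)
    then have "(1 + s) * \<bar>f (\<Sum>i\<in>I. x i * \<omega> i)\<bar> \<le> (1 + s) * (C * (?B * (1 + s)) ^ k)"
      using s by (intro mult_left_mono) auto
    also have "\<dots> = C * ?B ^ k * (1 + s) ^ Suc k" by (simp add: power_mult_distrib)
    also have "\<dots> \<le> C * ?B ^ k * (D * exp (s / 2))"
      using C(1) s by (intro mult_left_mono D) auto
    also have "exp (s / 2) = (\<Prod>i\<in>I. exp (\<bar>\<omega> i\<bar> / 2))"
      using assms(2) by (simp add: s_def sum_divide_distrib exp_sum)
    finally show "(1 + (\<Sum>i\<in>I. \<bar>\<omega> i\<bar>)) * \<bar>f (\<Sum>i\<in>I. x i * \<omega> i)\<bar> \<le> C * ?B ^ k * D * (\<Prod>i\<in>I. exp (\<bar>\<omega> i\<bar> / 2))"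
      by (simp add: s_def mult_ac)
  qed
qed

text \<open>The weight \<open>g\<close> is used in two instances: the constant 1 gives continuity of
  the moments in the coefficients, a coordinate \<open>\<omega> j\<close> gives continuity of their
  partial derivatives.\<close>

lemma weighted_dominated_convergence:
  assumes f: "continuous_on UNIV f" "poly_growth f" and I: "finite (I :: nat set)"
    and g[measurable]: "g \<in> borel_measurable (Pi\<^sub>M I (\<lambda>_. expD))"
    and gb: "\<And>\<omega>. \<bar>g \<omega>\<bar> \<le> 1 + (\<Sum>i\<in>I. \<bar>\<omega> i\<bar>)"
  shows "integrable (Pi\<^sub>M I (\<lambda>_. expD)) (\<lambda>\<omega>. g \<omega> * f (\<Sum>i\<in>I. x i * \<omega> i))" (is "?A x")
    and "(\<And>i. i \<in> I \<Longrightarrow> (\<lambda>n. y n i) \<longlonglongrightarrow> x i) \<Longrightarrow>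
      (\<lambda>n. \<integral>\<omega>. g \<omega> * f (\<Sum>i\<in>I. y n i * \<omega> i) \<partial>Pi\<^sub>M I (\<lambda>_. expD))
        \<longlonglongrightarrow> (\<integral>\<omega>. g \<omega> * f (\<Sum>i\<in>I. x i * \<omega> i) \<partial>Pi\<^sub>M I (\<lambda>_. expD))"
proof -
  have fm[measurable]: "f \<in> borel_measurable borel"
    using f(1) by (rule borel_measurable_continuous_onI)
  have dom: "integrable (Pi\<^sub>M I (\<lambda>_. expD)) (\<lambda>\<omega>. C * (\<Prod>i\<in>I. exp (\<bar>\<omega> i\<bar> / 2)))" for C :: real
    using expPi.product_integrable_prod[where f="\<lambda>_ u. exp (\<bar>u\<bar> / 2)", OF I integrable_expD_exp_half] by (rule integrable_mult_right)
  have bound: "\<exists>C. \<forall>x \<omega>. (\<forall>i\<in>I. \<bar>x i\<bar> \<le> B) \<longrightarrow>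
      norm (g \<omega> * f (\<Sum>i\<in>I. x i * \<omega> i)) \<le> C * (\<Prod>i\<in>I. exp (\<bar>\<omega> i\<bar> / 2))" for B
  proof -
    obtain C where C: "\<And>x \<omega>. (\<And>i. i \<in> I \<Longrightarrow> \<bar>x i\<bar> \<le> B) \<Longrightarrow>
     (1 + (\<Sum>i\<in>I. \<bar>\<omega> i\<bar>)) * \<bar>f (\<Sum>i\<in>I. x i * \<omega> i)\<bar> \<le> C * (\<Prod>i\<in>I. exp (\<bar>\<omega> i\<bar> / 2))"
      using poly_growth_dominated[OF f(2) I] by blast
    show ?thesis
    proof (intro exI allI impI)
      fix x \<omega> :: "nat \<Rightarrow> real" assume x: "\<forall>i\<in>I. \<bar>x i\<bar> \<le> B"
      have "norm (g \<omega> * f (\<Sum>i\<in>I. x i * \<omega> i)) \<le> (1 + (\<Sum>i\<in>I. \<bar>\<omega> i\<bar>)) * \<bar>f (\<Sum>i\<in>I. x i * \<omega> i)\<bar>"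
        unfolding real_norm_def abs_mult by (intro mult_right_mono gb) auto
      also have "\<dots> \<le> C * (\<Prod>i\<in>I. exp (\<bar>\<omega> i\<bar> / 2))" using x by (intro C) auto
      finally show "norm (g \<omega> * f (\<Sum>i\<in>I. x i * \<omega> i)) \<le> C * (\<Prod>i\<in>I. exp (\<bar>\<omega> i\<bar> / 2))" .
    qed
  qed
  show "?A x"
  proof -
    obtain C where C: "\<And>\<omega>. norm (g \<omega> * f (\<Sum>i\<in>I. x i * \<omega> i)) \<le> C * (\<Prod>i\<in>I. exp (\<bar>\<omega> i\<bar> / 2))"
    proof -
      have "\<forall>i\<in>I. \<bar>x i\<bar> \<le> Max ((\<lambda>i. \<bar>x i\<bar>) ` I)" using I by auto
      with bound[of "Max ((\<lambda>i. \<bar>x i\<bar>) ` I)"] that show ?thesis by blast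
    qed
    show ?thesis
    proof (rule Bochner_Integration.integrable_bound[OF dom[of C]])
      show "AE \<omega> in Pi\<^sub>M I (\<lambda>_. expD). norm (g \<omega> * f (\<Sum>i\<in>I. x i * \<omega> i)) \<le> norm (C * (\<Prod>i\<in>I. exp (\<bar>\<omega> i\<bar> / 2)))"
        by (intro AE_I2 order_trans[OF C]) simp
    qed measurable
  qed
  assume y: "\<And>i. i \<in> I \<Longrightarrow> (\<lambda>n. y n i) \<longlonglongrightarrow> x i"
  have "\<exists>B. \<forall>i\<in>I. \<forall>n. \<bar>y n i\<bar> \<le> B"
  proof -
    have "\<exists>K. \<forall>n. \<bar>y n i\<bar> \<le> K" if "i \<in> I" for i
      using convergent_imp_Bseq[OF convergentI[OF y[OF that]]] by (auto simp: Bseq_def)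
    then obtain K where K: "\<And>i n. i \<in> I \<Longrightarrow> \<bar>y n i\<bar> \<le> K i" by metis
    have "\<bar>y n i\<bar> \<le> Max (K ` I)" if "i \<in> I" for i n
      using I that by (intro order_trans[OF K Max_ge]) auto
    then show ?thesis by blast
  qed
  then obtain B where B: "\<And>i n. i \<in> I \<Longrightarrow> \<bar>y n i\<bar> \<le> B" by blast
  obtain C where C: "\<And>x \<omega>. (\<forall>i\<in>I. \<bar>x i\<bar> \<le> B) \<Longrightarrow>
      norm (g \<omega> * f (\<Sum>i\<in>I. x i * \<omega> i)) \<le> C * (\<Prod>i\<in>I. exp (\<bar>\<omega> i\<bar> / 2))" using bound[of B] by blast
  show "(\<lambda>n. \<integral>\<omega>. g \<omega> * f (\<Sum>i\<in>I. y n i * \<omega> i) \<partial>Pi\<^sub>M I (\<lambda>_. expD))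
        \<longlonglongrightarrow> (\<integral>\<omega>. g \<omega> * f (\<Sum>i\<in>I. x i * \<omega> i) \<partial>Pi\<^sub>M I (\<lambda>_. expD))"
  proof (rule integral_dominated_convergence[OF _ _ dom[of C]])
    show "AE \<omega> in Pi\<^sub>M I (\<lambda>_. expD). (\<lambda>n. g \<omega> * f (\<Sum>i\<in>I. y n i * \<omega> i)) \<longlonglongrightarrow> g \<omega> * f (\<Sum>i\<in>I. x i * \<omega> i)"
      using f(1) y by (intro AE_I2 tendsto_mult tendsto_const continuous_on_tendsto_compose[OF f(1)] tendsto_sum) auto
    show "AE \<omega> in Pi\<^sub>M I (\<lambda>_. expD). norm (g \<omega> * f (\<Sum>i\<in>I. y n i * \<omega> i)) \<le> C * (\<Prod>i\<in>I. exp (\<bar>\<omega> i\<bar> / 2))" for n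
      using B by (intro AE_I2 C) auto
  qed measurable
qed

lemma
  assumes f: "continuous_on UNIV f" "poly_growth f" and I: "finite (I :: nat set)"
  shows esum_integrable: "integrable (Pi\<^sub>M I (\<lambda>_. expD)) (\<lambda>\<omega>. f (\<Sum>i\<in>I. x i * \<omega> i))"
    and esum_tendsto: "(\<And>i. i \<in> I \<Longrightarrow> (\<lambda>n. y n i) \<longlonglongrightarrow> x i) \<Longrightarrow> (\<lambda>n. esum I (y n) f) \<longlonglongrightarrow> esum I x f"
proof -
  have 1: "\<bar>1::real\<bar> \<le> 1 + (\<Sum>i\<in>I. \<bar>\<omega> i :: real\<bar>)" for \<omega>
    by (simp add: sum_nonneg)
  show "integrable (Pi\<^sub>M I (\<lambda>_. expD)) (\<lambda>\<omega>. f (\<Sum>i\<in>I. x i * \<omega> i))"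
    using weighted_dominated_convergence(1)[OF assms borel_measurable_const 1] by simp
  show "(\<lambda>n. esum I (y n) f) \<longlonglongrightarrow> esum I x f" if "\<And>i. i \<in> I \<Longrightarrow> (\<lambda>n. y n i) \<longlonglongrightarrow> x i"
    using weighted_dominated_convergence(2)[OF assms borel_measurable_const 1 that] by (simp add: esum_def)
qed

lemma abs_le_1_plus_sum: "finite (I :: nat set) \<Longrightarrow> i \<in> I \<Longrightarrow> \<bar>\<omega> i\<bar> \<le> 1 + (\<Sum>i\<in>I. \<bar>\<omega> i :: real\<bar>)"
  using member_le_sum[of i I "\<lambda>i. \<bar>\<omega> i\<bar>"] by auto

lemma
  assumes f: "continuous_on UNIV f" "poly_growth f" and I: "finite (I :: nat set)" "j \<in> I"
  shows esum_coord_integrable: "integrable (Pi\<^sub>M I (\<lambda>_. expD)) (\<lambda>\<omega>. \<omega> j * f (\<Sum>i\<in>I. x i * \<omega> i))"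
    and esum_coord_tendsto: "(\<And>i. i \<in> I \<Longrightarrow> (\<lambda>n. y n i) \<longlonglongrightarrow> x i) \<Longrightarrow>
      (\<lambda>n. \<integral>\<omega>. \<omega> j * f (\<Sum>i\<in>I. y n i * \<omega> i) \<partial>Pi\<^sub>M I (\<lambda>_. expD))
        \<longlonglongrightarrow> (\<integral>\<omega>. \<omega> j * f (\<Sum>i\<in>I. x i * \<omega> i) \<partial>Pi\<^sub>M I (\<lambda>_. expD))"
proof -
  have g: "(\<lambda>\<omega>. \<omega> j) \<in> borel_measurable (Pi\<^sub>M I (\<lambda>_. expD))"
    using measurable_component_singleton[OF I(2), of "\<lambda>_. expD"] by simp
  show "integrable (Pi\<^sub>M I (\<lambda>_. expD)) (\<lambda>\<omega>. \<omega> j * f (\<Sum>i\<in>I. x i * \<omega> i))"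
    by (rule weighted_dominated_convergence[OF assms(1-3) g abs_le_1_plus_sum[OF I]])
  show "(\<lambda>n. \<integral>\<omega>. \<omega> j * f (\<Sum>i\<in>I. y n i * \<omega> i) \<partial>Pi\<^sub>M I (\<lambda>_. expD))
        \<longlonglongrightarrow> (\<integral>\<omega>. \<omega> j * f (\<Sum>i\<in>I. x i * \<omega> i) \<partial>Pi\<^sub>M I (\<lambda>_. expD))"
    if "\<And>i. i \<in> I \<Longrightarrow> (\<lambda>n. y n i) \<longlonglongrightarrow> x i"
    by (rule weighted_dominated_convergence(2)[OF assms(1-3) g abs_le_1_plus_sum[OF I] that])
qed

lemma esum_insert:
  assumes f: "continuous_on UNIV f" "poly_growth f" and I: "finite I" "k \<notin> I"
  shows "esum (insert k I) x f = esum I x (\<lambda>z. \<integral>u. f (z + x k * u) \<partial>expD)"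
proof -
  have *: "(\<Sum>i\<in>insert k I. x i * (if i = k then u else \<omega> i)) = (\<Sum>i\<in>I. x i * \<omega> i) + x k * u" for \<omega> u
    using I by (simp add: add.commute cong: sum.cong_simp) (auto intro!: sum.cong)
  show ?thesis
    unfolding esum_def
    by (subst expPi.product_integral_insert[OF I esum_integrable[OF f]]) (use I in \<open>simp_all add: * del: sum.insert\<close>)
qed

lemma esum_cong: "(\<And>i. i \<in> I \<Longrightarrow> x i = y i) \<Longrightarrow> esum I x f = esum I y f"
  unfolding esum_def by (metis (mono_tags, lifting) sum.cong)

lemma expD_integrable:
  assumes f: "continuous_on UNIV f" "poly_growth f"
  shows "integrable expD (\<lambda>u. f (z + a * u))"
    and "integrable expD (\<lambda>u. u * f (z + a * u))"
    and "((\<lambda>u. exp (- u) * f (z + a * u)) \<longlongrightarrow> 0) at_top"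
proof -
  have fm[measurable]: "f \<in> borel_measurable borel"
    using f(1) by (rule borel_measurable_continuous_onI)
  have "poly_growth (\<lambda>w. f (z + w))"
  proof -
    obtain C k where C: "C \<ge> 0" "\<And>z. \<bar>f z\<bar> \<le> C * (1 + \<bar>z\<bar>) ^ k" using f poly_growthE by blast
    show ?thesis
    proof (rule poly_growthI)
      fix w
      have "\<bar>f (z + w)\<bar> \<le> C * (1 + \<bar>z + w\<bar>) ^ k" by (rule C)
      also have "\<dots> \<le> C * ((1 + \<bar>z\<bar>) * (1 + \<bar>w\<bar>)) ^ k"
      proof -
        have "1 + \<bar>z + w\<bar> \<le> (1 + \<bar>z\<bar>) * (1 + \<bar>w\<bar>)"
          using abs_triangle_ineq[of z w] mult_nonneg_nonneg[of "\<bar>z\<bar>" "\<bar>w\<bar>"] by (simp only: algebra_simps mult_1_left mult_1_right) linarith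
        then show ?thesis using C(1) by (intro mult_left_mono power_mono) auto
      qed
      finally show "\<bar>f (z + w)\<bar> \<le> (C * (1 + \<bar>z\<bar>) ^ k) * (1 + \<bar>w\<bar>) ^ k"
        by (simp add: power_mult_distrib)
    qed
  qed
  \<comment> \<open>A one-point index set reduces the product bound to a bound in one variable
    \<open>u\<close>; its factor \<open>1 + |u|\<close> covers both \<open>f\<close> and
    \<open>u * f\<close>.\<close>
  have "finite {0::nat}" by simp
  from poly_growth_dominated[OF \<open>poly_growth (\<lambda>w. f (z + w))\<close> this, of "\<bar>a\<bar>"]
  obtain C where C: "C \<ge> 0" "\<And>x \<omega>. (\<And>i. i \<in> {0::nat} \<Longrightarrow> \<bar>x i\<bar> \<le> \<bar>a\<bar>) \<Longrightarrow>
     (1 + (\<Sum>i\<in>{0}. \<bar>\<omega> i\<bar>)) * \<bar>f (z + (\<Sum>i\<in>{0}. x i * \<omega> i))\<bar> \<le> C * (\<Prod>i\<in>{0}. exp (\<bar>\<omega> i\<bar> / 2))"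
    by blast
  have *: "(1 + \<bar>u\<bar>) * \<bar>f (z + a * u)\<bar> \<le> C * exp (\<bar>u\<bar> / 2)" for u
    using C(2)[of "\<lambda>_. a" "\<lambda>_. u"] by simp
  have 1: "\<bar>f (z + a * u)\<bar> \<le> C * exp (\<bar>u\<bar> / 2)" for u
    by (rule order_trans[OF _ *[of u]]) (simp add: algebra_simps)
  have 2: "\<bar>u * f (z + a * u)\<bar> \<le> C * exp (\<bar>u\<bar> / 2)" for u
    by (rule order_trans[OF _ *[of u]]) (simp add: algebra_simps abs_mult)
  have dom: "integrable expD (\<lambda>u. C * exp (\<bar>u\<bar> / 2))"
    by (intro integrable_mult_right integrable_expD_exp_half)
  show "integrable expD (\<lambda>u. f (z + a * u))"
    by (rule Bochner_Integration.integrable_bound[OF dom]) (use 1 C(1) in \<open>auto simp: abs_mult\<close>)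
  show "integrable expD (\<lambda>u. u * f (z + a * u))"
    by (rule Bochner_Integration.integrable_bound[OF dom]) (use 2 C(1) in \<open>auto simp: abs_mult\<close>)
  have lim: "((\<lambda>u::real. C * exp (- u / 2)) \<longlongrightarrow> 0) at_top"
    by (rule tendsto_mult_right_zero) real_asymp
  show "((\<lambda>u. exp (- u) * f (z + a * u)) \<longlongrightarrow> 0) at_top"
  proof (rule Lim_null_comparison[OF _ lim])
    show "\<forall>\<^sub>F u in at_top. norm (exp (- u) * f (z + a * u)) \<le> C * exp (- u / 2)"
      using eventually_ge_at_top[of 0]
    proof eventually_elim
      case (elim u)
      have "norm (exp (- u) * f (z + a * u)) \<le> exp (- u) * (C * exp (\<bar>u\<bar> / 2))"
        using 1[of u] by (simp add: abs_mult)
      also have "\<dots> = C * exp (- u / 2)" using elim by (simp add: mult_exp_exp field_simps)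
      finally show ?case .
    qed
  qed
qed

section \<open>Integration by parts and size biasing\<close>

lemma integral_expD:
  fixes f :: "real \<Rightarrow> 'a :: {banach, second_countable_topology}"
  assumes [measurable]: "f \<in> borel_measurable borel"
  shows "(\<integral>u. f u \<partial>expD) = (LBINT u=0..\<infinity>. exp (- u) *\<^sub>R f u)"
    and "integrable expD f \<longleftrightarrow> set_integrable lborel (einterval 0 \<infinity>) (\<lambda>u. exp (- u) *\<^sub>R f u)"
proof -
  have ein: "einterval 0 \<infinity> = {0::real<..}" by (auto simp: einterval_def)
  have *: "AE u in lborel. exponential_density 1 u *\<^sub>R f u = indicator {0<..} u *\<^sub>R exp (- u) *\<^sub>R f u"
    using AE_lborel_singleton[of "0::real"]
    by eventually_elim (auto simp: exponential_density_def indicator_def)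
  show "(\<integral>u. f u \<partial>expD) = (LBINT u=0..\<infinity>. exp (- u) *\<^sub>R f u)"
  proof -
    have "(\<integral>u. f u \<partial>expD) = (\<integral>u. exponential_density 1 u *\<^sub>R f u \<partial>lborel)"
      by (rule integral_density) (auto simp: exponential_density_nonneg)
    also have "\<dots> = (\<integral>u. indicator {0<..} u *\<^sub>R exp (- u) *\<^sub>R f u \<partial>lborel)"
      by (rule integral_cong_AE[OF _ _ *]) measurable
    finally show ?thesis
      by (simp add: interval_lebesgue_integral_def set_lebesgue_integral_def ein)
  qed
  show "integrable expD f \<longleftrightarrow> set_integrable lborel (einterval 0 \<infinity>) (\<lambda>u. exp (- u) *\<^sub>R f u)"
  proof -
    have "integrable expD f \<longleftrightarrow> integrable lborel (\<lambda>u. exponential_density 1 u *\<^sub>R f u)"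
      by (rule integrable_density) (auto simp: exponential_density_nonneg)
    also have "\<dots> \<longleftrightarrow> integrable lborel (\<lambda>u. indicator {0<..} u *\<^sub>R exp (- u) *\<^sub>R f u)"
      by (rule integrable_cong_AE[OF _ _ *]) measurable
    finally show ?thesis
      by (simp add: set_integrable_def ein)
  qed
qed

text \<open>The function \<open>- exp (- u) * f (z + a * u)\<close> is an antiderivative of
  \<open>exp (- u) * (f - a * f')\<close> taken at \<open>z + a * u\<close>. It tends to 0 at
  infinity by polynomial growth, and its value at 0 contributes \<open>f z\<close>.\<close>

lemma expD_by_parts:
  assumes f: "continuous_on UNIV f" "poly_growth f" and f': "continuous_on UNIV f'" "poly_growth f'"
    and der: "\<And>z. (f has_real_derivative f' z) (at z)"
  shows "(\<integral>u. f (z + a * u) \<partial>expD) = f z + a * (\<integral>u. f' (z + a * u) \<partial>expD)"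
proof -
  have fm[measurable]: "f \<in> borel_measurable borel" "f' \<in> borel_measurable borel"
    using f(1) f'(1) by (auto intro: borel_measurable_continuous_onI)
  note int = expD_integrable(1)[OF f, of z a] expD_integrable(1)[OF f', of z a]
  have cont: "continuous_on UNIV (\<lambda>u. f (z + a * u))" "continuous_on UNIV (\<lambda>u. f' (z + a * u))"
    by (rule continuous_on_compose2[OF f(1)], intro continuous_intros, simp)
      (rule continuous_on_compose2[OF f'(1)], intro continuous_intros, simp)
  let ?h = "\<lambda>u. f (z + a * u) - a * f' (z + a * u)"
  have "integrable expD ?h" using int by simp
  then have "set_integrable lborel (einterval 0 \<infinity>) (\<lambda>u. exp (- u) *\<^sub>R ?h u)"
    by (subst (asm) integral_expD(2)) auto
  have "(LBINT u=0..\<infinity>. exp (- u) *\<^sub>R ?h u) = 0 - (- f z)"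
  proof (rule interval_integral_FTC_integrable[where F = "\<lambda>u. - (exp (- u) * f (z + a * u))"])
    show "((\<lambda>u. - (exp (- u) * f (z + a * u))) has_vector_derivative exp (- u) *\<^sub>R ?h u) (at u)" for u
      unfolding has_real_derivative_iff_has_vector_derivative[symmetric]
      by (auto intro!: derivative_eq_intros DERIV_chain2[OF der] simp: algebra_simps)
    show "isCont (\<lambda>u. exp (- u) *\<^sub>R ?h u) u" for u
      using cont by (intro continuous_intros) (auto simp: continuous_on_eq_continuous_at)
    show "(((\<lambda>u. - (exp (- u) * f (z + a * u))) \<circ> real_of_ereal) \<longlongrightarrow> - f z) (at_right 0)"
    proof -
      have c: "isCont (\<lambda>u. - (exp (- u) * f (z + a * u))) 0"
        using cont by (intro continuous_intros) (auto simp: continuous_on_eq_continuous_at)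
      have "((\<lambda>u. - (exp (- u) * f (z + a * u))) \<longlongrightarrow> - f z) (at_right 0)"
        using c by (auto simp: isCont_def intro: tendsto_within_subset)
      then show ?thesis
        unfolding zero_ereal_def by (simp add: ereal_tendsto_simps)
    qed
    show "(((\<lambda>u. - (exp (- u) * f (z + a * u))) \<circ> real_of_ereal) \<longlongrightarrow> 0) (at_left \<infinity>)"
      using tendsto_minus[OF expD_integrable(3)[OF f, of z a]] by (simp add: ereal_tendsto_simps)
  qed (use \<open>set_integrable _ _ _\<close> in auto)
  then have "(\<integral>u. ?h u \<partial>expD) = f z" by (subst integral_expD(1)) auto
  then show ?thesis using int by simp
qed

text \<open>Fubini's theorem for the inner integral over one coordinate; it justifies splitting sums
  after that coordinate has been integrated out.\<close>

lemma integrable_expPi_insert: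
  fixes F :: "(nat \<Rightarrow> real) \<Rightarrow> real"
  assumes F: "integrable (Pi\<^sub>M (insert k I) (\<lambda>_. expD)) F" and I: "finite I"
  shows "integrable (Pi\<^sub>M I (\<lambda>_. expD)) (\<lambda>\<omega>. \<integral>u. F (fun_upd \<omega> k u) \<partial>expD)"
proof -
  interpret I: finite_product_sigma_finite "\<lambda>_. expD" I by standard fact
  interpret pair_sigma_finite expD "Pi\<^sub>M I (\<lambda>_. expD)" ..
  have [measurable]: "(\<lambda>p. fun_upd (snd p) k (fst p))
      \<in> measurable (expD \<Otimes>\<^sub>M Pi\<^sub>M I (\<lambda>_. expD)) (Pi\<^sub>M (insert k I) (\<lambda>_. expD))"
    by (rule measurable_fun_upd[where J = I]) auto
  have "distr (expD \<Otimes>\<^sub>M Pi\<^sub>M I (\<lambda>_. expD)) (Pi\<^sub>M (insert k I) (\<lambda>_. expD)) (\<lambda>p. fun_upd (snd p) k (fst p))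
      = Pi\<^sub>M (insert k I) (\<lambda>_. expD)"
    using distr_pair_PiM_eq_PiM[of I "\<lambda>_. expD" k] expD.prob_space_axioms by (simp add: case_prod_beta')
  then have "integrable (distr (expD \<Otimes>\<^sub>M Pi\<^sub>M I (\<lambda>_. expD)) (Pi\<^sub>M (insert k I) (\<lambda>_. expD)) (\<lambda>p. fun_upd (snd p) k (fst p))) F"
    using F by simp
  then have "integrable (expD \<Otimes>\<^sub>M Pi\<^sub>M I (\<lambda>_. expD)) (\<lambda>p. F (fun_upd (snd p) k (fst p)))"
    by (rule integrable_distr[rotated]) measurable
  then have "integrable (expD \<Otimes>\<^sub>M Pi\<^sub>M I (\<lambda>_. expD)) (\<lambda>(u, \<omega>). F (fun_upd \<omega> k u))"
    by (simp add: case_prod_beta')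
  from integrable_snd[OF this] show ?thesis .
qed

lemma esum_by_parts:
  assumes f: "continuous_on UNIV f" "poly_growth f" and f': "continuous_on UNIV f'" "poly_growth f'"
    and der: "\<And>z. (f has_real_derivative f' z) (at z)"
    and I: "finite I" "k \<notin> I"
  shows "esum (insert k I) x f = esum I x f + x k * esum (insert k I) x f'"
proof -
  have *: "(\<Sum>i\<in>insert k I. x i * (if i = k then u else \<omega> i)) = (\<Sum>i\<in>I. x i * \<omega> i) + x k * u" for \<omega> u
    using I by (simp add: add.commute cong: sum.cong_simp) (auto intro!: sum.cong)
  have sub: "finite (insert k I)" using I by simp
  have "esum (insert k I) x f = esum I x (\<lambda>z. f z + x k * (\<integral>u. f' (z + x k * u) \<partial>expD))"
    unfolding esum_insert[OF f I] expD_by_parts[OF f f' der] ..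
  also have "\<dots> = esum I x f + x k * esum I x (\<lambda>z. \<integral>u. f' (z + x k * u) \<partial>expD)"
  proof -
    have "integrable (Pi\<^sub>M I (\<lambda>_. expD)) (\<lambda>\<omega>. \<integral>u. f' ((\<Sum>i\<in>I. x i * \<omega> i) + x k * u) \<partial>expD)"
      using integrable_expPi_insert[OF esum_integrable[OF f' sub, of x] I(1)] by (simp add: * del: sum.insert)
    then show ?thesis
      unfolding esum_def using esum_integrable[OF f I(1), of x] by simp
  qed
  also have "esum I x (\<lambda>z. \<integral>u. f' (z + x k * u) \<partial>expD) = esum (insert k I) x f'"
    unfolding esum_insert[OF f' I] ..
  finally show ?thesis .
qed

text \<open>Weighting the exponential density by \<open>u\<close> gives
  \<open>u * exp (- u)\<close>, the density of a sum of two independent standard exponentials. Hence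
  a factor \<open>u\<close> can be traded for a second independent copy.\<close>

lemma expD_size_bias:
  assumes f: "continuous_on UNIV f" "poly_growth f"
  shows "(\<integral>u. u * f (z + a * u) \<partial>expD) = (\<integral>u. \<integral>v. f (z + a * u + a * v) \<partial>expD \<partial>expD)"
proof -
  have fm[measurable]: "f \<in> borel_measurable borel"
    using f(1) by (rule borel_measurable_continuous_onI)
  interpret P: pair_sigma_finite expD expD ..
  let ?h = "\<lambda>w. f (z + a * w)"
  \<comment> \<open>The first argument of \<open>erlang_density\<close> is the shape minus one:
    \<open>erlang_density 1 1\<close> has shape 2, and \<open>erlang_density 0\<close> is the
    exponential density.\<close>
  have conv: "distr (expD \<Otimes>\<^sub>M expD) borel (\<lambda>(u, v). u + v) = density lborel (erlang_density 1 1)"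
  proof -
    have "convolution expD expD = density lborel (\<lambda>x. \<integral>\<^sup>+y. ennreal (exponential_density 1 (x - y)) * ennreal (exponential_density 1 y) \<partial>lborel)"
      by (rule convolution_density) (auto intro: expD.finite_measure_axioms)
    also have "\<dots> = density lborel (erlang_density 1 1)"
      using convolution_erlang_density[of 1 0 0] by simp
    finally show ?thesis by (simp add: convolution_def)
  qed
  have erl: "erlang_density 1 1 w = w * exponential_density 1 w" for w
    by (simp add: erlang_density_def)
  have "integrable expD (\<lambda>u. u * ?h u)" by (rule expD_integrable[OF f])
  then have "integrable lborel (\<lambda>w. exponential_density 1 w *\<^sub>R (w * ?h w))"
    by (subst (asm) integrable_density) (auto simp: exponential_density_nonneg)
  then have int: "integrable (density lborel (erlang_density 1 1)) ?h"
    by (subst integrable_density) (auto simp: erl[unfolded One_nat_def] mult_ac simp del: erlang_density_nonneg intro!: AE_I2 mult_nonneg_nonneg simp: exponential_density_def)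
  have "(\<integral>u. u * ?h u \<partial>expD) = (\<integral>w. erlang_density 1 1 w *\<^sub>R ?h w \<partial>lborel)"
    by (subst integral_density) (auto simp: exponential_density_nonneg erl[unfolded One_nat_def] mult_ac)
  also have "\<dots> = (\<integral>w. ?h w \<partial>density lborel (erlang_density 1 1))"
    by (subst integral_density) auto
  also have "\<dots> = (\<integral>p. ?h (fst p + snd p) \<partial>(expD \<Otimes>\<^sub>M expD))"
    unfolding conv[symmetric] by (subst integral_distr) (auto simp: case_prod_beta')
  also have "\<dots> = (\<integral>u. \<integral>v. ?h (u + v) \<partial>expD \<partial>expD)"
  proof -
    have "integrable (expD \<Otimes>\<^sub>M expD) (\<lambda>p. ?h ((\<lambda>(u, v). u + v) p))"
      by (rule integrable_distr[where M' = borel]) (use int conv in auto)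
    then have "integrable (expD \<Otimes>\<^sub>M expD) (\<lambda>(u, v). ?h (u + v))" by (simp add: case_prod_beta')
    from P.integral_fst'[OF this] show ?thesis by (simp add: case_prod_beta')
  qed
  finally show ?thesis by (simp add: algebra_simps)
qed

lemma esum_size_bias:
  assumes f: "continuous_on UNIV f" "poly_growth f" and I: "finite I" "i \<in> I" "k \<notin> I"
  shows "(\<integral>\<omega>. \<omega> i * f (\<Sum>j\<in>I. x j * \<omega> j) \<partial>Pi\<^sub>M I (\<lambda>_. expD)) = esum (insert k I) (fun_upd x k (x i)) f"
proof -
  obtain J where J: "I = insert i J" "i \<notin> J" using I(2) by (meson Set.set_insert)
  have finJ: "finite J" using I J by simp
  let ?y = "fun_upd x k (x i)"
  have ki: "k \<noteq> i" "k \<notin> J" using I J by auto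
  have S: "(\<Sum>j\<in>insert i J. x j * (if j = i then u else \<omega> j)) = (\<Sum>j\<in>J. x j * \<omega> j) + x i * u" for \<omega> u
    using finJ J(2) by (simp add: add.commute cong: sum.cong_simp) (auto intro!: sum.cong)
  have T: "(\<Sum>j\<in>insert k I. ?y j * (fun_upd \<omega> k u) j) = (\<Sum>j\<in>I. x j * \<omega> j) + x i * u" for \<omega> u
    using I by (simp add: add.commute cong: sum.cong_simp) (auto intro!: sum.cong)
  have fin: "finite (insert k I)" using I by simp
  have "(\<integral>\<omega>. \<omega> i * f (\<Sum>j\<in>I. x j * \<omega> j) \<partial>Pi\<^sub>M I (\<lambda>_. expD))
      = (\<integral>\<omega>. \<integral>u. u * f ((\<Sum>j\<in>J. x j * \<omega> j) + x i * u) \<partial>expD \<partial>Pi\<^sub>M J (\<lambda>_. expD))"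
    using expPi.product_integral_insert[OF finJ J(2) esum_coord_integrable[OF f I(1,2), of x, unfolded J(1)]]
    unfolding J(1) by (simp add: S del: sum.insert)
  also have "\<dots> = (\<integral>\<omega>. \<integral>u. \<integral>v. f ((\<Sum>j\<in>J. x j * \<omega> j) + x i * u + x i * v) \<partial>expD \<partial>expD \<partial>Pi\<^sub>M J (\<lambda>_. expD))"
    by (simp add: expD_size_bias[OF f])
  also have "\<dots> = (\<integral>\<omega>. \<integral>v. f ((\<Sum>j\<in>I. x j * \<omega> j) + x i * v) \<partial>expD \<partial>Pi\<^sub>M I (\<lambda>_. expD))"
  proof -
    have "integrable (Pi\<^sub>M I (\<lambda>_. expD)) (\<lambda>\<omega>. \<integral>v. f ((\<Sum>j\<in>I. x j * \<omega> j) + x i * v) \<partial>expD)"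
      using integrable_expPi_insert[OF esum_integrable[OF f fin, of ?y] I(1)] by (simp only: T)
    from expPi.product_integral_insert[OF finJ J(2) this[unfolded J(1)]] show ?thesis
      unfolding J(1) by (simp add: S del: sum.insert)
  qed
  also have "\<dots> = esum (insert k I) ?y f"
    unfolding esum_def
    by (subst expPi.product_integral_insert[OF I(1,3) esum_integrable[OF f fin]]) (simp only: T)
  finally show ?thesis .
qed

lemma esum_const: "finite I \<Longrightarrow> esum I x (\<lambda>_. c) = c"
  unfolding esum_def
  using prob_space.prob_space[OF prob_space_PiM[of I "\<lambda>_. expD"]] expD.prob_space_axioms by simp

text \<open>Expand the factor \<open>z\<close> into its summands \<open>x i * \<omega> i\<close> and
  size-bias each one. For monomials this is Euler's identity
  \<open>d h_d = sum_i x_i h_{d-1}(x, x_i)\<close>.\<close>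

lemma esum_mult_id:
  assumes f: "continuous_on UNIV f" "poly_growth f" and I: "finite I" "k \<notin> I"
  shows "esum I x (\<lambda>z. z * f z) = (\<Sum>i\<in>I. x i * esum (insert k I) (fun_upd x k (x i)) f)"
proof -
  have "esum I x (\<lambda>z. z * f z) = (\<integral>\<omega>. (\<Sum>i\<in>I. x i * (\<omega> i * f (\<Sum>i\<in>I. x i * \<omega> i))) \<partial>Pi\<^sub>M I (\<lambda>_. expD))"
    unfolding esum_def by (simp add: sum_distrib_right mult.assoc)
  also have "\<dots> = (\<Sum>i\<in>I. x i * (\<integral>\<omega>. \<omega> i * f (\<Sum>i\<in>I. x i * \<omega> i) \<partial>Pi\<^sub>M I (\<lambda>_. expD)))"
    by (subst Bochner_Integration.integral_sum) (auto intro!: esum_coord_integrable f I)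
  finally show ?thesis using esum_size_bias[OF f I(1) _ I(2)] by simp
qed

section \<open>Powers of the absolute value: growth, derivatives, tangents\<close>

lemma poly_growth_const: "poly_growth (\<lambda>_. c)"
  by (rule poly_growthI[of _ "\<bar>c\<bar>" 0]) simp

lemma poly_growth_id: "poly_growth (\<lambda>z. z)"
  by (rule poly_growthI[of _ 1 1]) simp

lemma poly_growth_mult:
  assumes "poly_growth f" "poly_growth g" shows "poly_growth (\<lambda>z. f z * g z)"
proof -
  obtain C k where C: "C \<ge> 0" "\<And>z. \<bar>f z\<bar> \<le> C * (1 + \<bar>z\<bar>) ^ k" using assms poly_growthE by blast
  obtain D l where D: "D \<ge> 0" "\<And>z. \<bar>g z\<bar> \<le> D * (1 + \<bar>z\<bar>) ^ l" using assms poly_growthE by blast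
  have "\<bar>f z * g z\<bar> \<le> (C * (1 + \<bar>z\<bar>) ^ k) * (D * (1 + \<bar>z\<bar>) ^ l)" for z
    unfolding abs_mult using C D by (intro mult_mono) auto
  then show ?thesis by (intro poly_growthI[of _ "C * D" "k + l"]) (simp add: power_add mult_ac)
qed

lemma poly_growth_powr: "p \<ge> 0 \<Longrightarrow> poly_growth (\<lambda>z. \<bar>z\<bar> powr p)"
proof (rule poly_growthI[of _ 1 "nat \<lceil>p\<rceil>"])
  fix z :: real assume p: "p \<ge> 0"
  have "\<bar>z\<bar> powr p \<le> (1 + \<bar>z\<bar>) powr p" by (rule powr_mono2) (use p in auto)
  also have "\<dots> \<le> (1 + \<bar>z\<bar>) powr (real (nat \<lceil>p\<rceil>))" by (rule powr_mono) (use p in auto)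
  also have "\<dots> = (1 + \<bar>z\<bar>) ^ nat \<lceil>p\<rceil>" by (rule powr_realpow) auto
  finally show "\<bar>\<bar>z\<bar> powr p\<bar> \<le> 1 * (1 + \<bar>z\<bar>) ^ nat \<lceil>p\<rceil>" by simp
qed

lemma continuous_abs_powr: "p > 0 \<Longrightarrow> continuous_on UNIV (\<lambda>z::real. \<bar>z\<bar> powr p)"
  by (intro continuous_on_powr' continuous_intros) auto

lemma has_derivative_signed_powr:
  assumes "r > 0"
  shows "((\<lambda>z::real. z * \<bar>z\<bar> powr r) has_real_derivative (r + 1) * \<bar>z\<bar> powr r) (at z)"
proof (cases "z = 0")
  case True
  have "continuous_on UNIV (\<lambda>z::real. \<bar>z\<bar> powr r)" by (rule continuous_abs_powr[OF assms])
  then have "(\<lambda>z::real. \<bar>z\<bar> powr r) \<midarrow>0\<rightarrow> \<bar>0\<bar> powr r"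
    unfolding continuous_on_def by blast
  then have "(\<lambda>z::real. \<bar>z\<bar> powr r) \<midarrow>0\<rightarrow> 0" by simp
  then have "(\<lambda>h. (h * \<bar>h\<bar> powr r) / h) \<midarrow>0\<rightarrow> 0"
    by (rule Lim_transform_eventually) (auto simp: eventually_at intro!: exI[of _ 1] )
  then show ?thesis using True by (simp add: DERIV_def)
next
  case False
  \<comment> \<open>Here \<open>s\<close> stands for the sign of \<open>z\<close>, so that one
    computation with \<open>(s * z) powr r\<close> serves both half-lines.\<close>
  have D: "((\<lambda>z. z * (s * z) powr r) has_real_derivative (r + 1) * \<bar>z\<bar> powr r) (at z)" if "s * z = \<bar>z\<bar>" "s \<noteq> 0" for s
  proof -
    have pos: "s * z > 0" using that False by simp
    have "s * (z * (r * (s * z) powr (r - 1))) = r * ((s * z) powr (r - 1) * (s * z) powr 1)"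
      using pos by simp
    also have "\<dots> = r * (s * z) powr r" unfolding powr_add[symmetric] by simp
    finally have "s * (z * (r * (s * z) powr (r - 1))) = r * (s * z) powr r" .
    then show ?thesis
      using pos by (auto intro!: derivative_eq_intros simp: that(1)[symmetric] algebra_simps)
  qed
  show ?thesis
  proof (cases "z > 0")
    case True
    have "((\<lambda>z. z * (1 * z) powr r) has_real_derivative (r + 1) * \<bar>z\<bar> powr r) (at z)"
      using True by (intro D) auto
    then show ?thesis
      by (rule has_field_derivative_transform_within_open[where S = "{0<..}"]) (use True in auto)
  next
    case neg: False
    have "((\<lambda>z. z * ((-1) * z) powr r) has_real_derivative (r + 1) * \<bar>z\<bar> powr r) (at z)"
      using neg False by (intro D) auto
    then show ?thesis
      by (rule has_field_derivative_transform_within_open[where S = "{..<0}"]) (use neg False in auto)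
  qed
qed

lemma powr_le_tangent:
  fixes v s :: real assumes "v \<ge> 0" "0 \<le> s" "s \<le> 1" shows "v powr s \<le> 1 + s * (v - 1)"
proof (cases "v = 0")
  case False
  then have v: "v > 0" using assms by simp
  have "exp ((1 - s) *\<^sub>R 0 + s *\<^sub>R ln v) \<le> (1 - s) * exp 0 + s * exp (ln v)"
    by (rule convex_onD[OF exp_convex]) (use assms in auto)
  then show ?thesis using v by (simp add: powr_def algebra_simps)
qed (use assms in auto)

text \<open>The concave tangent bound with exponent \<open>1 / r\<close>, applied to
  \<open>v powr r\<close>.\<close>

lemma powr_ge_tangent:
  fixes v r :: real assumes v: "v \<ge> 0" and r: "1 \<le> r" shows "v powr r \<ge> 1 + r * (v - 1)"
proof -
  have "(v powr r) powr (1 / r) \<le> 1 + 1 / r * (v powr r - 1)"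
    by (rule powr_le_tangent) (use r in auto)
  then have "v \<le> 1 + (v powr r - 1) / r" using v r by (simp add: powr_powr)
  then show ?thesis using r by (simp add: field_simps)
qed

text \<open>Convexity of \<open>|z|^p\<close>, with the tangent taken at \<open>u\<close> and
  evaluated at \<open>v\<close>. Scaling reduces it to \<open>powr_ge_tangent\<close> at
  \<open>|v| / |u|\<close>, and \<open>u * v <= |u| * |v|\<close> takes care of the signs.\<close>

lemma abs_powr_ge_tangent:
  fixes u v :: real assumes p: "p > 2"
  shows "\<bar>u\<bar> powr p \<le> \<bar>v\<bar> powr p + p * (u * \<bar>u\<bar> powr (p - 2)) * (u - v)"
proof (cases "u = 0")
  case False
  then have u: "\<bar>u\<bar> > 0" by simp
  have P1: "\<bar>u\<bar> powr p = \<bar>u\<bar> powr (p - 2) * u * u"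
    using powr_add[of "\<bar>u\<bar>" "p - 2" 2] u by (simp add: power2_eq_square)
  have "(\<bar>v\<bar> / \<bar>u\<bar>) powr p \<ge> 1 + p * (\<bar>v\<bar> / \<bar>u\<bar> - 1)"
    by (rule powr_ge_tangent) (use p in auto)
  then have "\<bar>u\<bar> powr p * (1 + p * (\<bar>v\<bar> / \<bar>u\<bar> - 1)) \<le> \<bar>u\<bar> powr p * (\<bar>v\<bar> / \<bar>u\<bar>) powr p"
    by (intro mult_left_mono) auto
  also have "\<dots> = \<bar>v\<bar> powr p" using u by (simp add: powr_divide)
  also have "\<bar>u\<bar> powr p * (1 + p * (\<bar>v\<bar> / \<bar>u\<bar> - 1)) = \<bar>u\<bar> powr p + p * (\<bar>u\<bar> powr (p - 2) * (\<bar>u\<bar> * \<bar>v\<bar>) - \<bar>u\<bar> powr p)"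
    using u unfolding P1 by (simp add: field_simps abs_mult_self_eq)
  finally have "\<bar>u\<bar> powr p + p * (\<bar>u\<bar> powr (p - 2) * (\<bar>u\<bar> * \<bar>v\<bar>) - \<bar>u\<bar> powr p) \<le> \<bar>v\<bar> powr p" .
  moreover have "p * (\<bar>u\<bar> powr (p - 2) * (u * v)) \<le> p * (\<bar>u\<bar> powr (p - 2) * (\<bar>u\<bar> * \<bar>v\<bar>))"
    using p by (intro mult_left_mono) (auto simp: abs_mult[symmetric])
  ultimately show ?thesis unfolding P1 by (simp add: algebra_simps)
qed auto

section \<open>Minimisers on the unit sphere\<close>

lemma signed_powr_regular:
  assumes "r > 0"
  shows "continuous_on UNIV (\<lambda>z::real. z * \<bar>z\<bar> powr r)" "poly_growth (\<lambda>z. z * \<bar>z\<bar> powr r)"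
  using assms by (intro continuous_on_mult continuous_on_id continuous_abs_powr poly_growth_mult
      poly_growth_id poly_growth_powr; simp)+

text \<open>Vectors are functions on all naturals in the product topology. Fixing the coordinates
  outside \<open>I\<close> to 0 puts the sphere into a product of compact intervals, where
  Tychonoff's theorem applies.\<close>

lemma compact_unit_sphere:
  assumes "finite I"
  shows "compact {x :: nat \<Rightarrow> real. (\<forall>i. i \<notin> I \<longrightarrow> x i = 0) \<and> (\<Sum>i\<in>I. (x i)\<^sup>2) = 1}" (is "compact ?S")
proof -
  define K :: "(nat \<Rightarrow> real) set" where "K = (\<Pi>\<^sub>E i\<in>UNIV. if i \<in> I then {-1..1} else {0})"
  have "compactin (product_topology (\<lambda>_::nat. euclideanreal) UNIV) K"
    unfolding K_def by (simp add: compactin_PiE)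
  then have K: "compact K" by (simp add: euclidean_product_topology)
  have "closed {x :: nat \<Rightarrow> real. (\<Sum>i\<in>I. (x i)\<^sup>2) = 1}"
    by (intro closed_Collect_eq continuous_on_sum continuous_on_power continuous_on_const continuous_on_product_coordinates)
  then have "compact (K \<inter> {x. (\<Sum>i\<in>I. (x i)\<^sup>2) = 1})"
    using K by (intro compact_Int_closed) auto
  also have "K \<inter> {x. (\<Sum>i\<in>I. (x i)\<^sup>2) = 1} = ?S"
  proof -
    have "x i \<in> {-1..1}" if "i \<in> I" "(\<Sum>i\<in>I. (x i)\<^sup>2) = 1" for x :: "nat \<Rightarrow> real" and i
    proof -
      have "(x i)\<^sup>2 \<le> (\<Sum>i\<in>I. (x i)\<^sup>2)" using that assms by (intro member_le_sum) auto
      then have "\<bar>x i\<bar> \<le> 1" using that by (simp add: abs_square_le_1)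
      then show ?thesis by auto
    qed
    moreover have "x \<in> K \<longleftrightarrow> (\<forall>i. (i \<in> I \<longrightarrow> x i \<in> {-1..1}) \<and> (i \<notin> I \<longrightarrow> x i = 0))" for x
      unfolding K_def PiE_iff by (simp add: extensional_def split: if_splits)
    ultimately show ?thesis by blast
  qed
  finally show ?thesis .
qed

lemma esum_attains_inf:
  assumes f: "continuous_on UNIV f" "poly_growth f" and I: "finite I" "I \<noteq> {}"
  obtains x where "(\<Sum>i\<in>I. (x i)\<^sup>2) = 1" "\<And>y. (\<Sum>i\<in>I. (y i)\<^sup>2) = 1 \<Longrightarrow> esum I x f \<le> esum I y f"
proof -
  define S where "S = {x :: nat \<Rightarrow> real. (\<forall>i. i \<notin> I \<longrightarrow> x i = 0) \<and> (\<Sum>i\<in>I. (x i)\<^sup>2) = 1}"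
  obtain k where k: "k \<in> I" using I by blast
  have "(\<Sum>i\<in>I. (if i = k then 1 else 0 :: real)\<^sup>2) = (\<Sum>i\<in>I. if i = k then 1 else 0)"
    by (intro sum.cong) auto
  then have "(\<lambda>i. if i = k then 1 else 0) \<in> S"
    unfolding S_def using k I(1) by (simp add: sum.delta)
  then have ne: "S \<noteq> {}" by blast
  have cont: "continuous_on S (\<lambda>x. esum I x f)"
    unfolding continuous_on_sequentially o_def
  proof (intro allI ballI impI)
    fix y :: "nat \<Rightarrow> nat \<Rightarrow> real" and x assume "(\<forall>n. y n \<in> S) \<and> y \<longlonglongrightarrow> x"
    then have lim: "y \<longlonglongrightarrow> x" by blast
    have "(\<lambda>n. y n i) \<longlonglongrightarrow> x i" for i
      by (rule continuous_on_tendsto_compose[OF continuous_on_product_coordinates[of i] lim]) simp_all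
    then show "(\<lambda>n. esum I (y n) f) \<longlonglongrightarrow> esum I x f" by (rule esum_tendsto[OF f I(1)])
  qed
  have "compact S" unfolding S_def by (rule compact_unit_sphere[OF I(1)])
  from continuous_attains_inf[OF this ne cont]
  obtain x where x: "x \<in> S" "\<And>y. y \<in> S \<Longrightarrow> esum I x f \<le> esum I y f"
    by blast
  show thesis
  proof (rule that)
    show "(\<Sum>i\<in>I. (x i)\<^sup>2) = 1" using x(1) by (simp add: S_def)
    fix y assume y: "(\<Sum>i\<in>I. (y i)\<^sup>2) = (1::real)"
    \<comment> \<open>An arbitrary competitor is replaced by its restriction to \<open>I\<close>,
      which lies in the compact set; \<open>esum\<close> sees only the coordinates in
      \<open>I\<close>.\<close>
    have "(\<Sum>i\<in>I. (if i \<in> I then y i else 0)\<^sup>2) = (\<Sum>i\<in>I. (y i)\<^sup>2)"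
      by (rule sum.cong) simp_all
    then have "(\<lambda>i. if i \<in> I then y i else 0) \<in> S"
      using y unfolding S_def by simp
    then have "esum I x f \<le> esum I (\<lambda>i. if i \<in> I then y i else 0) f"
      by (rule x(2))
    also have "\<dots> = esum I y f" by (rule esum_cong) simp
    finally show "esum I x f \<le> esum I y f" .
  qed
qed

lemma esum_scale: "esum I (\<lambda>i. c * x i) (\<lambda>z. \<bar>z\<bar> powr p) = \<bar>c\<bar> powr p * esum I x (\<lambda>z. \<bar>z\<bar> powr p)"
proof -
  have "\<bar>\<Sum>i\<in>I. c * x i * \<omega> i\<bar> powr p = \<bar>c\<bar> powr p * \<bar>\<Sum>i\<in>I. x i * \<omega> i\<bar> powr p" for \<omega>
  proof -
    have "(\<Sum>i\<in>I. c * x i * \<omega> i) = c * (\<Sum>i\<in>I. x i * \<omega> i)"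
      by (simp add: sum_distrib_left mult.assoc)
    then show ?thesis by (simp add: abs_mult powr_mult)
  qed
  then show ?thesis unfolding esum_def by simp
qed

lemma esum_powr_nonneg: "esum I x (\<lambda>z. \<bar>z\<bar> powr p) \<ge> 0"
  unfolding esum_def by (intro Bochner_Integration.integral_nonneg) auto

lemma esum_powr_ge_of_unit:
  assumes I: "finite I" and m: "\<And>y. (\<Sum>i\<in>I. (y i)\<^sup>2) = 1 \<Longrightarrow> m \<le> esum I y (\<lambda>z. \<bar>z\<bar> powr p)"
  shows "m * (\<Sum>i\<in>I. (x i)\<^sup>2) powr (p / 2) \<le> esum I x (\<lambda>z. \<bar>z\<bar> powr p)"
proof (cases "(\<Sum>i\<in>I. (x i)\<^sup>2) = 0")
  case True
  \<comment> \<open>The left side is 0, since \<open>0 powr (p / 2) = 0\<close>.\<close>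
  then show ?thesis using esum_powr_nonneg by simp
next
  case False
  define c where "c = sqrt (\<Sum>i\<in>I. (x i)\<^sup>2)"
  have S: "(\<Sum>i\<in>I. (x i)\<^sup>2) > 0" using False sum_nonneg[of I "\<lambda>i. (x i)\<^sup>2"] by simp
  then have c: "c > 0" "c\<^sup>2 = (\<Sum>i\<in>I. (x i)\<^sup>2)" unfolding c_def by auto
  have "m \<le> esum I (\<lambda>i. 1 / c * x i) (\<lambda>z. \<bar>z\<bar> powr p)"
    using c S by (intro m) (simp add: power_divide sum_divide_distrib[symmetric])
  then have "m * c powr p \<le> esum I (\<lambda>i. 1 / c * x i) (\<lambda>z. \<bar>z\<bar> powr p) * c powr p"
    by (intro mult_right_mono) auto
  also have "\<dots> = esum I x (\<lambda>z. \<bar>z\<bar> powr p)"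
    unfolding esum_scale using c by (simp add: powr_divide)
  finally have le: "m * c powr p \<le> esum I x (\<lambda>z. \<bar>z\<bar> powr p)" .
  then show ?thesis
  proof -
    have "(c\<^sup>2) powr (p / 2) = c powr p"
      using c(1) powr_powr[of c 2 "p / 2"] by simp
    then show ?thesis using le c(2) by simp
  qed
qed

text \<open>Convexity of \<open>|z|\<^sup>p\<close> bounds the difference quotients of the moment from above, the homogeneous
  extension of minimality bounds them from below; differentiation under the integral is not needed.\<close>
lemma esum_minimizer_gradient:
  assumes I: "finite I" "i \<in> I" and p: "p > 2" and x: "(\<Sum>i\<in>I. (x i)\<^sup>2) = 1"
    and min: "\<And>y. (\<Sum>i\<in>I. (y i)\<^sup>2) = 1 \<Longrightarrow> esum I x (\<lambda>z. \<bar>z\<bar> powr p) \<le> esum I y (\<lambda>z. \<bar>z\<bar> powr p)"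
  shows "(\<integral>\<omega>. \<omega> i * ((\<Sum>j\<in>I. x j * \<omega> j) * \<bar>\<Sum>j\<in>I. x j * \<omega> j\<bar> powr (p - 2)) \<partial>Pi\<^sub>M I (\<lambda>_. expD))
    = esum I x (\<lambda>z. \<bar>z\<bar> powr p) * x i"
proof -
  define m where "m = esum I x (\<lambda>z. \<bar>z\<bar> powr p)"
  define f where "f z = z * \<bar>z\<bar> powr (p - 2)" for z :: real
  define D where "D y = (\<integral>\<omega>. \<omega> i * f (\<Sum>j\<in>I. y j * \<omega> j) \<partial>Pi\<^sub>M I (\<lambda>_. expD))" for y
  define X where "X h j = x j + (if j = i then h else 0)" for h j
  \<comment> \<open>\<open>K h\<close> is the lower bound from homogeneity for the moment at
    \<open>X h\<close>, which is \<open>x\<close> with its \<open>i\<close>-th coordinate raised by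
    \<open>h\<close>; the squared length of \<open>X h\<close> is
    \<open>1 + 2 * h * x i + h^2\<close>, so \<open>K\<close> has slope \<open>m * p * x i\<close>
    at 0.\<close>
  define K where "K h = m * (1 + 2 * h * x i + h\<^sup>2) powr (p / 2)" for h
  have f: "continuous_on UNIV f" "poly_growth f" unfolding f_def
    using signed_powr_regular[of "p - 2"] p by auto
  have g: "continuous_on UNIV (\<lambda>z::real. \<bar>z\<bar> powr p)" "poly_growth (\<lambda>z. \<bar>z\<bar> powr p)"
    using p by (auto intro: continuous_abs_powr poly_growth_powr)
  have S: "(\<Sum>j\<in>I. X h j * \<omega> j) = (\<Sum>j\<in>I. x j * \<omega> j) + h * \<omega> i" for h \<omega>
  proof -
    have "(\<Sum>j\<in>I. X h j * \<omega> j) = (\<Sum>j\<in>I. x j * \<omega> j + (if j = i then h * \<omega> i else 0))"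
      unfolding X_def by (intro sum.cong) (auto simp: algebra_simps)
    then show ?thesis using I by (simp add: sum.distrib)
  qed
  have Q: "(\<Sum>j\<in>I. (X h j)\<^sup>2) = 1 + 2 * h * x i + h\<^sup>2" for h
  proof -
    have "(\<Sum>j\<in>I. (X h j)\<^sup>2) = (\<Sum>j\<in>I. (x j)\<^sup>2 + (if j = i then 2 * h * x i + h\<^sup>2 else 0))"
      unfolding X_def by (intro sum.cong) (auto simp: power2_eq_square algebra_simps)
    then show ?thesis using I x by (simp add: sum.distrib)
  qed
  have K0: "K 0 = m" by (simp add: K_def)
  \<comment> \<open>The tangent of \<open>|z|^p\<close> is taken at the perturbed point, so the
    bound contains \<open>D (X h)\<close>; continuity of \<open>D\<close> along \<open>X h\<close>
    then suffices in the limit.\<close>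
  have le: "K h - K 0 \<le> h * (p * D (X h))" for h
  proof -
    have "K h \<le> esum I (X h) (\<lambda>z. \<bar>z\<bar> powr p)"
      unfolding K_def m_def Q[symmetric] by (rule esum_powr_ge_of_unit[OF I(1) min])
    also have "\<dots> \<le> (\<integral>\<omega>. \<bar>\<Sum>j\<in>I. x j * \<omega> j\<bar> powr p + h * p * (\<omega> i * f (\<Sum>j\<in>I. X h j * \<omega> j)) \<partial>Pi\<^sub>M I (\<lambda>_. expD))"
      unfolding esum_def
    proof (rule integral_mono)
      show "integrable (Pi\<^sub>M I (\<lambda>_. expD)) (\<lambda>\<omega>. \<bar>\<Sum>i\<in>I. X h i * \<omega> i\<bar> powr p)"
        by (rule esum_integrable[OF g I(1)])
      show "integrable (Pi\<^sub>M I (\<lambda>_. expD)) (\<lambda>\<omega>. \<bar>\<Sum>j\<in>I. x j * \<omega> j\<bar> powr p + h * p * (\<omega> i * f (\<Sum>j\<in>I. X h j * \<omega> j)))"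
        by (intro Bochner_Integration.integrable_add integrable_mult_right esum_integrable[OF g I(1)] esum_coord_integrable[OF f I])
      show "\<bar>\<Sum>j\<in>I. X h j * \<omega> j\<bar> powr p \<le> \<bar>\<Sum>j\<in>I. x j * \<omega> j\<bar> powr p + h * p * (\<omega> i * f (\<Sum>j\<in>I. X h j * \<omega> j))" for \<omega>
        using abs_powr_ge_tangent[OF p, of "\<Sum>j\<in>I. X h j * \<omega> j" "\<Sum>j\<in>I. x j * \<omega> j"]
        unfolding f_def S by (simp add: mult_ac)
    qed
    also have "\<dots> = m + h * p * D (X h)"
      unfolding m_def esum_def D_def
      using esum_integrable[OF g I(1), of x] esum_coord_integrable[OF f I, of "X h"] by simp
    finally show ?thesis by (simp add: K0 algebra_simps)
  qed
  have der: "(K has_real_derivative m * p * x i) (at 0)"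
    unfolding K_def by (auto intro!: derivative_eq_intros)
  \<comment> \<open>The sign of \<open>c\<close> is the side from which 0 is approached;
    \<open>c = 1\<close> and \<open>c = -1\<close> give the two inequalities.\<close>
  have key: "c * (m * x i) \<le> c * D x" if c: "c \<noteq> 0" for c
  proof -
    define a where "a n = 1 / real (Suc n)" for n
    have a: "a \<longlonglongrightarrow> 0" "\<And>n. a n > 0"
      unfolding a_def using LIMSEQ_inverse_real_of_nat by (simp_all add: inverse_eq_divide)
    have ca: "(\<lambda>n. c * a n) \<longlonglongrightarrow> 0" using tendsto_mult_right_zero[OF a(1)] by simp
    have fl: "filterlim (\<lambda>n. c * a n) (at 0) sequentially"
    proof (rule filterlim_atI[OF ca])
      show "\<forall>\<^sub>F n in sequentially. c * a n \<noteq> 0"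
        using c a(2) by (metis (mono_tags) eventually_sequentiallyI mult_eq_0_iff less_irrefl)
    qed
    have "(\<lambda>h. (K (0 + h) - K 0) / h) \<midarrow>0\<rightarrow> m * p * x i" using der by (simp add: DERIV_def)
    from filterlim_compose[OF this fl]
    have l1: "(\<lambda>n. c * ((K (c * a n) - K 0) / (c * a n))) \<longlonglongrightarrow> c * (m * p * x i)"
      by (intro tendsto_mult tendsto_const) simp
    have "(\<lambda>n. D (X (c * a n))) \<longlonglongrightarrow> D x"
      unfolding D_def
    proof (rule esum_coord_tendsto[OF f I])
      show "(\<lambda>n. X (c * a n) j) \<longlonglongrightarrow> x j" for j
        unfolding X_def using tendsto_add[OF tendsto_const ca, of "x j"] by (cases "j = i") simp_all
    qed
    then have l2: "(\<lambda>n. c * (p * D (X (c * a n)))) \<longlonglongrightarrow> c * (p * D x)"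
      by (intro tendsto_mult tendsto_const)
    have "c * ((K (c * a n) - K 0) / (c * a n)) \<le> c * (p * D (X (c * a n)))" for n
    proof -
      have "c * ((K (c * a n) - K 0) / (c * a n)) = (K (c * a n) - K 0) / a n"
        using c by simp
      also have "\<dots> \<le> (c * a n * (p * D (X (c * a n)))) / a n"
        by (rule divide_right_mono[OF le less_imp_le[OF a(2)]])
      also have "\<dots> = c * (p * D (X (c * a n)))" using a(2)[of n] by simp
      finally show ?thesis .
    qed
    from LIMSEQ_le[OF l1 l2] this have "c * (m * p * x i) \<le> c * (p * D x)" by blast
    then have "p * (c * (m * x i)) \<le> p * (c * D x)" by (simp add: mult_ac)
    then show ?thesis using p by simp
  qed
  from key[of 1] key[of "-1"] have "D x = m * x i" by simp
  then show ?thesis by (simp add: D_def f_def m_def)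
qed

section \<open>Reduction of the exponent at a minimiser\<close>

text \<open>With \<open>f z = z |z|^(p-2)\<close> and \<open>m\<close> the minimum, the gradient
  condition and size biasing give \<open>E f(X + x_i E') = m x_i\<close>, and likewise for
  \<open>j\<close>. Integration by parts then computes \<open>E f(X + x_i E' + x_j E'')\<close> in
  two ways, as \<open>m x_i + x_j R\<close> and as \<open>m x_j + x_i R\<close> with
  \<open>R = (p - 1) E|X + x_i E' + x_j E''|^(p-2)\<close>. Subtracting leaves
  \<open>(x_i - x_j) (m - R) = 0\<close>.\<close>

lemma esum_minimum_distinct:
  assumes I: "finite I" "i \<in> I" "j \<in> I" and p: "p > 2" and x: "(\<Sum>i\<in>I. (x i)\<^sup>2) = 1"
    and min: "\<And>y. (\<Sum>i\<in>I. (y i)\<^sup>2) = 1 \<Longrightarrow> esum I x (\<lambda>z. \<bar>z\<bar> powr p) \<le> esum I y (\<lambda>z. \<bar>z\<bar> powr p)"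
    and ij: "x i \<noteq> x j" and kl: "k \<notin> I" "l \<notin> insert k I"
  shows "esum I x (\<lambda>z. \<bar>z\<bar> powr p) =
    (p - 1) * esum (insert l (insert k I)) (fun_upd (fun_upd x k (x i)) l (x j)) (\<lambda>z. \<bar>z\<bar> powr (p - 2))"
proof -
  define m where "m = esum I x (\<lambda>z. \<bar>z\<bar> powr p)"
  define f where "f z = z * \<bar>z\<bar> powr (p - 2)" for z :: real
  define y where "y = fun_upd (fun_upd x k (x i)) l (x j)"
  let ?J = "insert l (insert k I)"
  let ?f' = "\<lambda>z. (p - 1) * \<bar>z\<bar> powr (p - 2)"
  have f: "continuous_on UNIV f" "poly_growth f" unfolding f_def
    using signed_powr_regular[of "p - 2"] p by auto
  have f': "continuous_on UNIV ?f'" "poly_growth ?f'"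
    using p by (auto intro!: continuous_on_mult_left continuous_abs_powr poly_growth_mult poly_growth_const poly_growth_powr)
  have der: "(f has_real_derivative ?f' z) (at z)" for z
    using has_derivative_signed_powr[of "p - 2" z] p unfolding f_def by simp
  have grad: "esum (insert n I) (fun_upd x n (x i)) f = m * x i" if "n \<notin> I" "i \<in> I" for n i
    using esum_minimizer_gradient[OF I(1) that(2) p x min] esum_size_bias[OF f I(1) that(2,1)]
    unfolding f_def m_def by simp
  have "m * x i = esum (insert k I) (fun_upd x k (x i)) f" using grad I kl by simp
  also have "\<dots> = esum (insert k I) y f"
    by (rule esum_cong) (use kl in \<open>auto simp: y_def\<close>)
  finally have 1: "esum ?J y f = m * x i + x j * esum ?J y ?f'"
    using esum_by_parts[OF f f' der, of "insert k I" l y] I kl by (simp add: y_def)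
  have "m * x j = esum (insert l I) (fun_upd x l (x j)) f" using grad I kl by simp
  also have "\<dots> = esum (insert l I) y f"
    by (rule esum_cong) (use kl in \<open>auto simp: y_def\<close>)
  finally have 2: "esum ?J y f = m * x j + x i * esum ?J y ?f'"
    using esum_by_parts[OF f f' der, of "insert l I" k y] I kl by (simp add: y_def insert_commute)
  from 1 2 have "(x i - x j) * (m - esum ?J y ?f') = 0" by (simp add: algebra_simps)
  then have "m = esum ?J y ?f'" using ij by simp
  then show ?thesis unfolding m_def y_def esum_def by simp
qed

lemma unit_vector_constant:
  assumes "finite I" "(\<Sum>i\<in>I. (x i)\<^sup>2) = (1::real)" "\<And>i. i \<in> I \<Longrightarrow> x i = a"
  shows "a \<noteq> 0" "real (card I) * a\<^sup>2 = 1"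
proof -
  have "(\<Sum>i\<in>I. (x i)\<^sup>2) = real (card I) * a\<^sup>2" using assms(3) by simp
  then show "real (card I) * a\<^sup>2 = 1" using assms by simp
  then show "a \<noteq> 0" by auto
qed

text \<open>Without two distinct coordinates nothing can be divided out. Instead
  \<open>z |z|^(p-2)\<close> is expanded by \<open>esum_mult_id\<close> over the
  \<open>1 + card I\<close> coordinates of the enlarged vector; all terms coincide, and the common
  factor \<open>a\<close> cancels.\<close>

lemma esum_minimum_equal:
  assumes I: "finite I" "i \<in> I" and p: "p > 2" and x: "(\<Sum>i\<in>I. (x i)\<^sup>2) = 1"
    and min: "\<And>y. (\<Sum>i\<in>I. (y i)\<^sup>2) = 1 \<Longrightarrow> esum I x (\<lambda>z. \<bar>z\<bar> powr p) \<le> esum I y (\<lambda>z. \<bar>z\<bar> powr p)"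
    and eq: "\<And>i. i \<in> I \<Longrightarrow> x i = a" and kl: "k \<notin> I" "l \<notin> insert k I"
  shows "esum I x (\<lambda>z. \<bar>z\<bar> powr p) =
    (1 + card I) * esum (insert l (insert k I)) (\<lambda>_. a) (\<lambda>z. \<bar>z\<bar> powr (p - 2))"
proof -
  define m where "m = esum I x (\<lambda>z. \<bar>z\<bar> powr p)"
  define f where "f z = z * \<bar>z\<bar> powr (p - 2)" for z :: real
  have f: "continuous_on UNIV f" "poly_growth f" unfolding f_def
    using signed_powr_regular[of "p - 2"] p by auto
  have f': "continuous_on UNIV (\<lambda>z::real. \<bar>z\<bar> powr (p - 2))" "poly_growth (\<lambda>z. \<bar>z\<bar> powr (p - 2))"
    using p by (auto intro: continuous_abs_powr poly_growth_powr)
  have "m * a = esum (insert k I) (fun_upd x k (x i)) f"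
    using esum_minimizer_gradient[OF I p x min] esum_size_bias[OF f I kl(1)] eq[OF I(2)]
    unfolding f_def m_def by simp
  also have "\<dots> = esum (insert k I) (\<lambda>_. a) f"
    by (rule esum_cong) (use eq I in auto)
  also have "\<dots> = (\<Sum>j\<in>insert k I. a * esum (insert l (insert k I)) (fun_upd (\<lambda>_. a) l a) (\<lambda>z. \<bar>z\<bar> powr (p - 2)))"
    unfolding f_def by (rule esum_mult_id[OF f']) (use I kl in auto)
  also have "\<dots> = a * ((1 + card I) * esum (insert l (insert k I)) (\<lambda>_. a) (\<lambda>z. \<bar>z\<bar> powr (p - 2)))"
    using I kl by (simp add: fun_upd_idem)
  finally show ?thesis
    using unit_vector_constant(1)[OF I(1) x eq] by (simp add: m_def)
qed

text \<open>Two applications of \<open>esum_mult_id\<close>, with \<open>f = 1\<close> and then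
  \<open>f z = z\<close>; in the second, the repeated coordinate produces the sum of
  squares.\<close>

lemma
  assumes "finite I"
  shows esum_id: "esum I x (\<lambda>z. z) = (\<Sum>i\<in>I. x i)"
    and esum_square: "esum I x (\<lambda>z. z\<^sup>2) = (\<Sum>i\<in>I. x i)\<^sup>2 + (\<Sum>i\<in>I. (x i)\<^sup>2)"
proof -
  have id: "esum I x (\<lambda>z. z) = (\<Sum>i\<in>I. x i)" if I: "finite I" for I x
  proof -
    obtain k where k: "k \<notin> I" using I by (meson ex_new_if_finite infinite_UNIV_nat)
    show ?thesis
      using esum_mult_id[OF continuous_on_const poly_growth_const[of 1] I k, of x] I by (simp add: esum_const)
  qed
  then show "esum I x (\<lambda>z. z) = (\<Sum>i\<in>I. x i)" using assms .
  obtain k where k: "k \<notin> I" using assms by (meson ex_new_if_finite infinite_UNIV_nat)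
  have "(\<Sum>j\<in>insert k I. fun_upd x k (x i) j) = x i + (\<Sum>j\<in>I. x j)" for i
    using assms k by (simp cong: sum.cong_simp) (auto intro!: sum.cong)
  then have "esum I x (\<lambda>z. z * z) = (\<Sum>i\<in>I. x i * (x i + (\<Sum>j\<in>I. x j)))"
    using esum_mult_id[OF continuous_on_id poly_growth_id assms k, of x] assms by (simp add: id)
  also have "\<dots> = (\<Sum>i\<in>I. x i)\<^sup>2 + (\<Sum>i\<in>I. (x i)\<^sup>2)"
    by (simp add: distrib_left sum.distrib sum_distrib_right[symmetric] power2_eq_square)
  finally show "esum I x (\<lambda>z. z\<^sup>2) = (\<Sum>i\<in>I. x i)\<^sup>2 + (\<Sum>i\<in>I. (x i)\<^sup>2)" by (simp add: power2_eq_square)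
qed

section \<open>Absolute moments of order below two\<close>

text \<open>The midpoint inequality for the convex function \<open>1 / t\<close> on
  \<open>[k - 1/2, k + 1/2]\<close>. With \<open>x = 1 / (2 * k)\<close> it reads
  \<open>2 * x <= ln ((1 + x) / (1 - x))\<close>.\<close>

lemma ln_ratio_ge:
  assumes k: "k > (1/2 :: real)"
  shows "1 / k \<le> ln ((k + 1/2) / (k - 1/2))"
proof -
  define x where "x = 1 / (2 * k)"
  have x: "0 \<le> x" "x < 1" using k by (auto simp: x_def field_simps)
  define f where "f x = ln (1 + x) - ln (1 - x) - 2 * x" for x :: real
  have "f 0 \<le> f x"
  proof (rule DERIV_nonneg_imp_nondecreasing[OF x(1)])
    fix y assume y: "0 \<le> y" "y \<le> x"
    then have y1: "y < 1" using x by simp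
    have d: "DERIV f y :> 1 / (1 + y) + 1 / (1 - y) - 2"
      unfolding f_def using y y1 by (auto intro!: derivative_eq_intros)
    have "(1 - y) * (1 + y) \<le> 1" "(1 + y) * (1 - y) \<le> 1"
      by (simp_all add: algebra_simps)
    then have "1 - y \<le> 1 / (1 + y)" "1 + y \<le> 1 / (1 - y)"
      using y y1 pos_le_divide_eq[of "1 + y" "1 - y" 1] pos_le_divide_eq[of "1 - y" "1 + y" 1] by auto
    then have "0 \<le> 1 / (1 + y) + 1 / (1 - y) - 2" by linarith
    with d show "\<exists>z. DERIV f y :> z \<and> 0 \<le> z" by blast
  qed
  then have "2 * x \<le> ln (1 + x) - ln (1 - x)" by (simp add: f_def)
  also have "\<dots> = ln ((1 + x) / (1 - x))" using x by (simp add: ln_div)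
  also have "(1 + x) / (1 - x) = (k + 1/2) / (k - 1/2)"
    using k by (simp add: x_def field_simps)
  finally show ?thesis by (simp add: x_def)
qed

text \<open>Log-convexity at \<open>k\<close>, written as a convex combination of
  \<open>k + s\<close> and \<open>k + s - 1\<close>. For \<open>s < 1/2\<close> this is weaker than
  the bound with \<open>k - 1/2\<close>, but both agree to leading order for large
  \<open>k\<close>.\<close>

lemma Gamma_shift_ge:
  assumes k: "k > 0" and s: "0 < s" "s < 1" and ks: "k + s > (1::real)"
  shows "(k + s - 1) powr s * Gamma k \<le> Gamma (k + s)"
proof -
  have "(ln \<circ> Gamma) ((1 - s) *\<^sub>R (k + s) + s *\<^sub>R (k + s - 1)) \<le> (1 - s) * (ln \<circ> Gamma) (k + s) + s * (ln \<circ> Gamma) (k + s - 1)"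
    by (rule convex_onD[OF log_convex_Gamma_real]) (use k s ks in auto)
  moreover have "(1 - s) *\<^sub>R (k + s) + s *\<^sub>R (k + s - 1) = k" by (simp add: algebra_simps)
  ultimately have 1: "ln (Gamma k) \<le> (1 - s) * ln (Gamma (k + s)) + s * ln (Gamma (k + s - 1))" by simp
  have "Gamma (k + s) = (k + s - 1) * Gamma (k + s - 1)"
    using Gamma_plus1[of "k + s - 1"] ks by (auto simp: nonpos_Ints_def)
  then have "ln (Gamma (k + s)) = ln (k + s - 1) + ln (Gamma (k + s - 1))"
  proof -
    have "Gamma (k + s - 1) > 0" by (rule Gamma_real_pos) (use ks in simp)
    then have "Gamma (k + s - 1) \<noteq> 0" by linarith
    then show ?thesis using ks \<open>Gamma (k + s) = _\<close> by (simp add: ln_mult)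
  qed
  with 1 have "ln (Gamma k) + s * ln (k + s - 1) \<le> ln (Gamma (k + s))" by (simp add: algebra_simps)
  then have "exp (ln (Gamma k) + s * ln (k + s - 1)) \<le> exp (ln (Gamma (k + s)))" by simp
  then show ?thesis using k s ks by (simp add: exp_add powr_def Gamma_real_pos mult_ac)
qed

text \<open>The ratio of the right to the left side decreases under \<open>k \<mapsto> k + 1\<close>, and log-convexity bounds it
  below by a sequence tending to 1.\<close>
lemma Gamma_shift_ge_half:
  assumes k: "k \<ge> 1" and s: "0 < s" "s < (1::real)"
  shows "(k - 1/2) powr s * Gamma k \<le> Gamma (k + s)"
proof -
  define r where "r n = Gamma (k + real n + s) / ((k + real n - 1/2) powr s * Gamma (k + real n))" for n
  have step: "r (Suc n) \<le> r n" for n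
  proof -
    define c where "c = k + real n"
    have c: "c \<ge> 1" using k by (simp add: c_def)
    \<comment> \<open>The quotient \<open>r (Suc n) / r n\<close> is \<open>1 + s / c\<close>
      divided by \<open>((c + 1/2) / (c - 1/2)) powr s\<close>. It is at most 1 because both
      logarithms are compared with \<open>s / c\<close>.\<close>
    have "ln (1 + s / c) \<le> s / c" by (rule ln_add_one_self_le_self) (use c s in auto)
    also have "\<dots> \<le> s * ln ((c + 1/2) / (c - 1/2))"
      using mult_left_mono[OF ln_ratio_ge[of c], of s] c s by simp
    finally have "exp (ln (1 + s / c)) \<le> exp (s * ln ((c + 1/2) / (c - 1/2)))" by simp
    then have "1 + s / c \<le> ((c + 1/2) / (c - 1/2)) powr s"
      using c s by (simp add: powr_def add_pos_pos)
    also have "\<dots> = (c + 1/2) powr s / (c - 1/2) powr s"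
      using c by (simp add: powr_divide)
    finally have *: "(c + s) / c * (c - 1/2) powr s \<le> (c + 1/2) powr s"
      using c by (simp add: field_simps)
    have g: "Gamma (c + 1 + s) = (c + s) * Gamma (c + s)" "Gamma (c + 1) = c * Gamma c"
      using Gamma_plus1[of "c + s"] Gamma_plus1[of c] c s by (auto simp: nonpos_Ints_def add_ac)
    have pos: "Gamma (c + s) > 0" "Gamma c > 0" "(c - 1/2) powr s > 0" "(c + 1/2) powr s > 0"
      using c s by (auto intro: Gamma_real_pos)
    have "r (Suc n) = Gamma (c + s) / Gamma c * ((c + s) / c / (c + 1/2) powr s)"
    proof -
      have "k + real (Suc n) + s = c + 1 + s" "k + real (Suc n) = c + 1" "k + real (Suc n) - 1/2 = c + 1/2"
        by (simp_all add: c_def)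
      then have "r (Suc n) = ((c + s) * Gamma (c + s)) / ((c + 1/2) powr s * (c * Gamma c))"
        unfolding r_def by (simp only: g)
      then show ?thesis by (simp add: mult_ac)
    qed
    also have "\<dots> \<le> Gamma (c + s) / Gamma c * (1 / (c - 1/2) powr s)"
    proof -
      have "x / B \<le> 1 / A" if "x * A \<le> B" "A > 0" "B > 0" for x A B :: real
        using that by (simp add: field_simps)
      from this[OF * pos(3,4)] show ?thesis using pos by (intro mult_left_mono) auto
    qed
    also have "\<dots> = r n" by (simp add: r_def c_def)
    finally show ?thesis .
  qed
  have r0: "r n \<le> r 0" for n
    by (induction n) (auto intro: order_trans[OF step])
  have "((k + real n + s - 1) / (k + real n - 1/2)) powr s \<le> r 0" if n: "n \<ge> 1" for n
  proof -
    have "(k + real n + s - 1) powr s * Gamma (k + real n) \<le> Gamma (k + real n + s)"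
      by (rule Gamma_shift_ge) (use k s n in auto)
    then have "(k + real n + s - 1) powr s / (k + real n - 1/2) powr s \<le> r n"
      unfolding r_def using k n Gamma_real_pos[of "k + real n"] by (simp add: field_simps)
    then show ?thesis using r0[of n] k s n by (simp add: powr_divide)
  qed
  then have ev: "\<forall>\<^sub>F n in sequentially. ((k + real n + s - 1) / (k + real n - 1/2)) powr s \<le> r 0"
    by (auto simp: eventually_sequentially)
  have "(\<lambda>n. (k + real n + s - 1) / (k + real n - 1/2)) \<longlonglongrightarrow> 1" by real_asymp
  then have "(\<lambda>n. ((k + real n + s - 1) / (k + real n - 1/2)) powr s) \<longlonglongrightarrow> 1 powr s"
    by (intro tendsto_powr tendsto_const) auto
  from tendsto_upperbound[OF this ev] have "1 \<le> r 0" by simp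
  then show ?thesis using k Gamma_real_pos[of k] by (simp add: r_def field_simps)
qed

section \<open>Power integrals over the positive half-line\<close>

lemma nn_integral_Gamma:
  assumes x: "x > 0" and c: "c > 0"
  shows "(\<integral>\<^sup>+u. ennreal (u powr (x - 1) * exp (- (c * u))) * indicator {0<..} u \<partial>lborel) = ennreal (Gamma x / c powr x)"
proof -
  have "((\<lambda>t. t powr (x - 1) / exp t) has_integral Gamma x) {0..}"
    by (rule Gamma_integral_real[OF x])
  then have "(\<integral>\<^sup>+u. ennreal (u powr (x - 1) / exp u) * indicator {0..} u \<partial>lborel) = ennreal (Gamma x)"
    by (intro nn_integral_has_integral_lebesgue') auto
  also have "(\<integral>\<^sup>+u. ennreal (u powr (x - 1) / exp u) * indicator {0..} u \<partial>lborel)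
      = (\<integral>\<^sup>+u. ennreal (u powr (x - 1) / exp u) * indicator {0<..} u \<partial>lborel)"
    by (intro nn_integral_cong) (auto simp: indicator_def)
  finally have 1: "(\<integral>\<^sup>+u. ennreal (u powr (x - 1) / exp u) * indicator {0<..} u \<partial>lborel) = ennreal (Gamma x)" .
  have "ennreal (Gamma x / c powr x) = ennreal (1 / c powr x) * ennreal (Gamma x)"
    using Gamma_real_pos[OF x] by (simp add: ennreal_mult[symmetric])
  also have "ennreal (Gamma x) = ennreal \<bar>c\<bar> * (\<integral>\<^sup>+u. ennreal ((0 + c * u) powr (x - 1) / exp (0 + c * u)) * indicator {0<..} (0 + c * u) \<partial>lborel)"
    unfolding 1[symmetric] by (rule nn_integral_real_affine) (use c in auto)
  also have "ennreal (1 / c powr x) * \<dots> =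
      (\<integral>\<^sup>+u. ennreal (1 / c powr x) * (ennreal \<bar>c\<bar> * (ennreal ((0 + c * u) powr (x - 1) / exp (0 + c * u)) * indicator {0<..} (0 + c * u))) \<partial>lborel)"
    by (simp add: nn_integral_cmult)
  also have "\<dots> = (\<integral>\<^sup>+u. ennreal (u powr (x - 1) * exp (- (c * u))) * indicator {0<..} u \<partial>lborel)"
  proof (intro nn_integral_cong)
    fix u :: real
    have "1 / c powr x * (c * ((c * u) powr (x - 1) / exp (c * u))) = u powr (x - 1) * exp (- (c * u))" if "u > 0"
      using c that by (simp add: powr_mult powr_diff exp_minus field_simps)
    then show "ennreal (1 / c powr x) * (ennreal \<bar>c\<bar> * (ennreal ((0 + c * u) powr (x - 1) / exp (0 + c * u)) * indicator {0<..} (0 + c * u)))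
      = ennreal (u powr (x - 1) * exp (- (c * u))) * indicator {0<..} u"
      using c by (auto simp: indicator_def zero_less_mult_iff ennreal_mult[symmetric])
  qed
  finally show ?thesis ..
qed

text \<open>For \<open>h = 1 - cos\<close> this is \<open>1 / C\<close> in \<open>|z|\<^sup>q = C \<integral> (1 - cos (t z)) t\<^sup>-\<^sup>1\<^sup>-\<^sup>q dt\<close>.\<close>
definition powr_transform :: "real \<Rightarrow> (real \<Rightarrow> real) \<Rightarrow> ennreal" where
  "powr_transform q h = (\<integral>\<^sup>+t. ennreal (h t * t powr (- 1 - q)) * indicator {0<..} t \<partial>lborel)"

lemma powr_transform_mono:
  assumes "\<And>t. t > 0 \<Longrightarrow> h t \<le> g t" shows "powr_transform q h \<le> powr_transform q g"
  unfolding powr_transform_def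
  by (intro nn_integral_mono) (auto simp: indicator_def intro!: ennreal_leI mult_right_mono assms)

text \<open>The measure \<open>t powr (- 1 - q) dt\<close> is homogeneous of degree
  \<open>- q\<close> under dilations; this is where the power \<open>c powr q\<close> comes from,
  whatever \<open>h\<close> is.\<close>

lemma powr_transform_scale:
  assumes [measurable]: "h \<in> borel_measurable borel" and c: "c > 0"
  shows "powr_transform q (\<lambda>t. h (t * c)) = ennreal (c powr q) * powr_transform q h"
proof -
  have "powr_transform q h = ennreal \<bar>c\<bar> * (\<integral>\<^sup>+t. ennreal (h (0 + c * t) * (0 + c * t) powr (- 1 - q)) * indicator {0<..} (0 + c * t) \<partial>lborel)"
    unfolding powr_transform_def by (rule nn_integral_real_affine) (use c in auto)
  then have "ennreal (c powr q) * powr_transform q h =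
      (\<integral>\<^sup>+t. ennreal (c powr q) * (ennreal \<bar>c\<bar> * (ennreal (h (0 + c * t) * (0 + c * t) powr (- 1 - q)) * indicator {0<..} (0 + c * t))) \<partial>lborel)"
    by (simp add: nn_integral_cmult)
  also have "\<dots> = powr_transform q (\<lambda>t. h (t * c))"
    unfolding powr_transform_def
  proof (intro nn_integral_cong)
    fix t :: real
    have "c powr q * (c * (h (c * t) * (c * t) powr (- 1 - q))) = h (t * c) * t powr (- 1 - q)" if "t > 0"
    proof -
      have "c powr q * c * c powr (- 1 - q) = c powr (q + 1 + (- 1 - q))"
        unfolding powr_add using c by simp
      then have "c powr q * c * c powr (- 1 - q) = 1" using c by simp
      then show ?thesis using c that by (simp add: powr_mult mult_ac)
    qed
    then show "ennreal (c powr q) * (ennreal \<bar>c\<bar> * (ennreal (h (0 + c * t) * (0 + c * t) powr (- 1 - q)) * indicator {0<..} (0 + c * t)))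
      = ennreal (h (t * c) * t powr (- 1 - q)) * indicator {0<..} t"
      using c by (auto simp: indicator_def zero_less_mult_iff ennreal_mult'[symmetric])
  qed
  finally show ?thesis ..
qed

text \<open>Tonelli's theorem followed by scaling with \<open>c = Z \<omega>\<close>. It is applied
  with \<open>1 - cos t\<close> and with \<open>1 - exp (- t^2 / 2)\<close>; the condition
  \<open>h 0 = 0\<close> settles the points where \<open>Z\<close> vanishes.\<close>

lemma powr_transform_mixture:
  assumes "prob_space M" and Z[measurable]: "Z \<in> borel_measurable M" and h[measurable]: "h \<in> borel_measurable borel"
    and h: "\<And>t. 0 \<le> h t" "\<And>t. h t \<le> B" "h 0 = 0" and Z0: "\<And>\<omega>. Z \<omega> \<ge> 0" and q: "q > 0"
  shows "powr_transform q (\<lambda>t. \<integral>\<omega>. h (t * Z \<omega>) \<partial>M) = (\<integral>\<^sup>+\<omega>. ennreal (Z \<omega> powr q) \<partial>M) * powr_transform q h"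
proof -
  interpret M: prob_space M by fact
  interpret pair_sigma_finite M "lborel :: real measure" ..
  have B: "B \<ge> 0" using h(1,2) order_trans by blast
  have int: "integrable M (\<lambda>\<omega>. h (t * Z \<omega>))" for t
    by (rule M.integrable_const_bound[of _ B]) (use h in auto)
  have "powr_transform q (\<lambda>t. \<integral>\<omega>. h (t * Z \<omega>) \<partial>M)
      = (\<integral>\<^sup>+t. (\<integral>\<^sup>+\<omega>. ennreal (h (t * Z \<omega>) * t powr (- 1 - q)) * indicator {0<..} t \<partial>M) \<partial>lborel)"
    unfolding powr_transform_def
  proof (intro nn_integral_cong)
    fix t :: real
    have "ennreal ((\<integral>\<omega>. h (t * Z \<omega>) \<partial>M) * t powr (- 1 - q)) = (\<integral>\<^sup>+\<omega>. ennreal (h (t * Z \<omega>) * t powr (- 1 - q)) \<partial>M)"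
      using h int by (subst nn_integral_eq_integral) auto
    then show "ennreal ((\<integral>\<omega>. h (t * Z \<omega>) \<partial>M) * t powr (- 1 - q)) * indicator {0<..} t
        = (\<integral>\<^sup>+\<omega>. ennreal (h (t * Z \<omega>) * t powr (- 1 - q)) * indicator {0<..} t \<partial>M)"
      by (subst nn_integral_multc) auto
  qed
  also have "\<dots> = (\<integral>\<^sup>+\<omega>. powr_transform q (\<lambda>t. h (t * Z \<omega>)) \<partial>M)"
    unfolding powr_transform_def by (rule Fubini') measurable
  also have "\<dots> = (\<integral>\<^sup>+\<omega>. ennreal (Z \<omega> powr q) * powr_transform q h \<partial>M)"
  proof (intro nn_integral_cong)
    fix \<omega>
    show "powr_transform q (\<lambda>t. h (t * Z \<omega>)) = ennreal (Z \<omega> powr q) * powr_transform q h"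
    proof (cases "Z \<omega> = 0")
      case True
      then show ?thesis using h(3) by (simp add: powr_transform_def)
    next
      case False
      then show ?thesis using Z0[of \<omega>] by (intro powr_transform_scale) auto
    qed
  qed
  finally show ?thesis by (simp add: nn_integral_multc)
qed

text \<open>These two facts allow the constant to be cancelled from an inequality. It is positive
  because the integrand is bounded below on \<open>[1, 2]\<close>, and finite because
  \<open>1 - cos t <= t^2\<close> near 0, where \<open>q < 2\<close> enters, and
  \<open>1 - cos t <= 2\<close> at infinity, where \<open>q > 0\<close> enters.\<close>

lemma powr_transform_one_minus_cos:
  assumes q: "0 < q" "q < 2"
  shows "powr_transform q (\<lambda>t. 1 - cos t) \<noteq> 0" "powr_transform q (\<lambda>t. 1 - cos t) \<noteq> \<infinity>"
proof -
  have "0 < ennreal ((1 - cos 1) * 2 powr (- 1 - q)) * emeasure lborel {1..2::real}"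
    using cos_monotone_0_pi[of 0 1] pi_gt3 by (auto simp: ennreal_zero_less_mult_iff)
  also have "\<dots> = (\<integral>\<^sup>+t. ennreal ((1 - cos 1) * 2 powr (- 1 - q)) * indicator {1..2::real} t \<partial>lborel)"
    by (subst nn_integral_cmult_indicator) auto
  also have "\<dots> \<le> powr_transform q (\<lambda>t. 1 - cos t)"
    unfolding powr_transform_def
  proof (intro nn_integral_mono)
    fix t :: real
    have "(1 - cos 1) * 2 powr (- 1 - q) \<le> (1 - cos t) * t powr (- 1 - q)" if "t \<in> {1..2}"
      using that q pi_gt3 by (intro mult_mono powr_mono2' diff_left_mono cos_monotone_0_pi_le) auto
    then show "ennreal ((1 - cos 1) * 2 powr (- 1 - q)) * indicator {1..2} t \<le> ennreal ((1 - cos t) * t powr (- 1 - q)) * indicator {0<..} t"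
      by (auto simp: indicator_def intro!: ennreal_leI)
  qed
  finally show "powr_transform q (\<lambda>t. 1 - cos t) \<noteq> 0" by simp
  have 1: "(\<integral>\<^sup>+t. ennreal (t powr (1 - q)) * indicator {0..1} t \<partial>lborel) < \<infinity>"
  proof -
    have "((\<lambda>t. t powr (1 - q)) has_integral (1 powr (1 - q + 1) / (1 - q + 1))) {0..1}"
      by (rule has_integral_powr_from_0) (use q in auto)
    then show ?thesis by (subst nn_integral_has_integral_lebesgue') auto
  qed
  have 2: "(\<integral>\<^sup>+t. ennreal (t powr (- 1 - q)) * indicator {1..} t \<partial>lborel) < \<infinity>"
  proof -
    have "((\<lambda>t. t powr (- 1 - q)) has_integral (- (1 powr (- 1 - q + 1)) / (- 1 - q + 1))) {1..}"
      by (rule has_integral_powr_to_inf) (use q in auto)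
    then show ?thesis by (subst nn_integral_has_integral_lebesgue') auto
  qed
  have "powr_transform q (\<lambda>t. 1 - cos t) \<le>
      (\<integral>\<^sup>+t. ennreal (t powr (1 - q)) * indicator {0..1} t + 2 * (ennreal (t powr (- 1 - q)) * indicator {1..} t) \<partial>lborel)"
    unfolding powr_transform_def
  proof (intro nn_integral_mono)
    fix t :: real
    have a: "ennreal ((1 - cos t) * t powr (- 1 - q)) \<le> ennreal (t powr (1 - q))" if "t > 0"
    proof (rule ennreal_leI)
      have "1 - cos t = 2 * (sin (t / 2))\<^sup>2" using cos_double_sin[of "t / 2"] by simp
      also have "\<dots> \<le> 2 * (t / 2)\<^sup>2"
        using abs_sin_x_le_abs_x[of "t / 2"] by (intro mult_left_mono abs_le_square_iff[THEN iffD1]) auto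
      also have "\<dots> \<le> t\<^sup>2" by (simp add: power2_eq_square)
      finally have "(1 - cos t) * t powr (- 1 - q) \<le> t powr 2 * t powr (- 1 - q)"
        using that by (intro mult_right_mono) auto
      also have "\<dots> = t powr (1 - q)" unfolding powr_add[symmetric] by simp
      finally show "(1 - cos t) * t powr (- 1 - q) \<le> t powr (1 - q)" .
    qed
    have b: "ennreal ((1 - cos t) * t powr (- 1 - q)) \<le> 2 * ennreal (t powr (- 1 - q))"
    proof -
      have "(1 - cos t) * t powr (- 1 - q) \<le> 2 * t powr (- 1 - q)"
        by (intro mult_right_mono) (use cos_ge_minus_one[of t] in auto)
      then have "ennreal ((1 - cos t) * t powr (- 1 - q)) \<le> ennreal (2 * t powr (- 1 - q))" by (rule ennreal_leI)
      then show ?thesis by (simp add: ennreal_mult)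
    qed
    show "ennreal ((1 - cos t) * t powr (- 1 - q)) * indicator {0<..} t \<le>
      ennreal (t powr (1 - q)) * indicator {0..1} t + 2 * (ennreal (t powr (- 1 - q)) * indicator {1..} t)"
    proof (cases "t > 0")
      case True
      show ?thesis
      proof (cases "t \<le> 1")
        case le: True
        then show ?thesis using a[OF True] True by (intro add_increasing2) auto
      next
        case False
        then show ?thesis using b by (auto simp: indicator_def)
      qed
    qed auto
  qed
  also have "\<dots> = (\<integral>\<^sup>+t. ennreal (t powr (1 - q)) * indicator {0..1} t \<partial>lborel) + 2 * (\<integral>\<^sup>+t. ennreal (t powr (- 1 - q)) * indicator {1..} t \<partial>lborel)"
    by (subst nn_integral_add) (auto simp: nn_integral_cmult)
  also have "\<dots> < \<infinity>" using 1 2 by (simp add: ennreal_mult_less_top)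
  finally show "powr_transform q (\<lambda>t. 1 - cos t) \<noteq> \<infinity>" by simp
qed

section \<open>Absolute moments of the standard Gaussian\<close>

definition gauss_moment :: "real \<Rightarrow> real" where
  "gauss_moment p = (\<integral>z. \<bar>z\<bar> powr p \<partial>std_normal_distribution)"

interpretation std_normal: real_distribution std_normal_distribution
  by (rule real_dist_normal_dist)

lemma std_normal_integrable:
  assumes [measurable]: "f \<in> borel_measurable borel" and "poly_growth f"
  shows "integrable std_normal_distribution f"
proof -
  obtain C k where C: "C \<ge> 0" "\<And>z. \<bar>f z\<bar> \<le> C * (1 + \<bar>z\<bar>) ^ k" using assms poly_growthE by blast
  have "integrable std_normal_distribution (\<lambda>z. \<bar>z\<bar> ^ k)"
    using integrable_abs[OF integrable_std_normal_distribution_moment[of k]] by (simp add: power_abs)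
  then have int: "integrable std_normal_distribution (\<lambda>z. C * (2 ^ k * (1 + \<bar>z\<bar> ^ k)))" by simp
  show ?thesis
  proof (rule Bochner_Integration.integrable_bound[OF int])
    have "(1 + \<bar>z\<bar>) ^ k \<le> 2 ^ k * (1 + \<bar>z\<bar> ^ k)" for z :: real
    proof (cases "\<bar>z\<bar> \<le> 1")
      case True
      then have "(1 + \<bar>z\<bar>) ^ k \<le> 2 ^ k" by (intro power_mono) auto
      then show ?thesis by (rule order_trans) (simp add: mult_le_cancel_left1)
    next
      case False
      then have "(1 + \<bar>z\<bar>) ^ k \<le> (2 * \<bar>z\<bar>) ^ k" by (intro power_mono) auto
      then show ?thesis by (rule order_trans) (simp add: power_mult_distrib)
    qed
    then have "\<bar>f z\<bar> \<le> C * (2 ^ k * (1 + \<bar>z\<bar> ^ k))" for z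
      by (intro order_trans[OF C(2)] mult_left_mono C(1)) auto
    then show "AE z in std_normal_distribution. norm (f z) \<le> norm (C * (2 ^ k * (1 + \<bar>z\<bar> ^ k)))"
      using C(1) by (intro AE_I2) simp
  qed simp
qed

lemma gauss_moment_integrable: "p \<ge> 0 \<Longrightarrow> integrable std_normal_distribution (\<lambda>z. \<bar>z\<bar> powr p)"
  by (intro std_normal_integrable poly_growth_powr) measurable

lemma gauss_moment_nonneg: "gauss_moment p \<ge> 0"
  unfolding gauss_moment_def by (intro Bochner_Integration.integral_nonneg) auto

lemma gauss_moment_le_1:
  assumes q: "0 \<le> q" "q \<le> 2" shows "gauss_moment q \<le> 1"
proof -
  have 2: "integrable std_normal_distribution (\<lambda>z. z\<^sup>2)" "(\<integral>z. z\<^sup>2 \<partial>std_normal_distribution) = 1"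
    using std_normal_distribution_even_moments[of 1] by auto
  \<comment> \<open>The tangent at 1 of the concave power \<open>q / 2\<close>, taken at
    \<open>z^2\<close>, whose mean is 1.\<close>
  have "gauss_moment q \<le> (\<integral>z. 1 + q / 2 * (z\<^sup>2 - 1) \<partial>std_normal_distribution)"
    unfolding gauss_moment_def
  proof (rule integral_mono)
    show "integrable std_normal_distribution (\<lambda>z. 1 + q / 2 * (z\<^sup>2 - 1))"
      using 2 by (intro Bochner_Integration.integrable_add integrable_mult_right Bochner_Integration.integrable_diff) auto
    show "\<bar>z\<bar> powr q \<le> 1 + q / 2 * (z\<^sup>2 - 1)" for z :: real
    proof (cases "z = 0")
      case False
      have "\<bar>z\<bar> powr q = (z\<^sup>2) powr (q / 2)"
        using False powr_powr[of "\<bar>z\<bar>" 2 "q / 2"] by simp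
      then show ?thesis using powr_le_tangent[of "z\<^sup>2" "q / 2"] q by simp
    qed (use q in auto)
  qed (use q gauss_moment_integrable in auto)
  also have "\<dots> = 1" using 2 std_normal.prob_space by simp
  finally show ?thesis .
qed

lemma gauss_moment_2: "gauss_moment 2 = 1"
  unfolding gauss_moment_def using std_normal_distribution_even_moments(1)[of 1] by simp

text \<open>Gaussian integration by parts with the same function \<open>z |z|^(p-2)\<close> as on
  the exponential side. The factor \<open>p - 1\<close> is the one in
  \<open>esum_minimum_distinct\<close>, so both sides of the comparison descend alike.\<close>

lemma gauss_moment_rec:
  assumes p: "p > 2" shows "gauss_moment p = (p - 1) * gauss_moment (p - 2)"
proof -
  define F where "F z = z * \<bar>z\<bar> powr (p - 2) * std_normal_density z" for z :: real
  define f where "f z = (p - 1) * \<bar>z\<bar> powr (p - 2) - \<bar>z\<bar> powr p" for z :: real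
  have int: "integrable std_normal_distribution (\<lambda>z. \<bar>z\<bar> powr (p - 2))" "integrable std_normal_distribution (\<lambda>z. \<bar>z\<bar> powr p)"
    using p by (auto intro: gauss_moment_integrable)
  then have fint: "integrable std_normal_distribution f" unfolding f_def by simp
  have [measurable]: "f \<in> borel_measurable borel" unfolding f_def by measurable
  have fint': "integrable lborel (\<lambda>z. std_normal_density z *\<^sub>R f z)"
    using fint by (subst (asm) integrable_density) auto
  have ein: "einterval (-\<infinity>) \<infinity> = (UNIV :: real set)" by (auto simp: einterval_def)
  have lim: "(F \<longlongrightarrow> 0) at_top"
  proof -
    have "((\<lambda>z. z powr (p - 1) * exp (- z\<^sup>2 / 2) / sqrt (2 * pi)) \<longlongrightarrow> 0) at_top"
      by (rule tendsto_divide_zero) (use p in real_asymp)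
    then show ?thesis
    proof (rule Lim_transform_eventually)
      show "\<forall>\<^sub>F z in at_top. z powr (p - 1) * exp (- z\<^sup>2 / 2) / sqrt (2 * pi) = F z"
        using eventually_gt_at_top[of 0]
      proof eventually_elim
        case (elim z)
        have "z * z powr (p - 2) = z powr (p - 1)"
          using elim powr_add[of z 1 "p - 2"] by simp
        then show ?case using elim by (simp add: F_def std_normal_density_def)
      qed
    qed
  qed
  have odd: "F (- z) = - F z" for z by (simp add: F_def std_normal_density_def)
  have lim': "(F \<longlongrightarrow> 0) at_bot"
    unfolding filterlim_at_bot_mirror odd using tendsto_minus[OF lim] by simp
  have "(LBINT z=-\<infinity>..\<infinity>. std_normal_density z *\<^sub>R f z) = 0 - 0"
  proof (rule interval_integral_FTC_integrable[where F = F])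
    show "(F has_vector_derivative std_normal_density z *\<^sub>R f z) (at z)" for z
    proof -
      have 1: "((\<lambda>z. z * \<bar>z\<bar> powr (p - 2)) has_real_derivative (p - 1) * \<bar>z\<bar> powr (p - 2)) (at z)"
        using has_derivative_signed_powr[of "p - 2" z] p by simp
      have 2: "(std_normal_density has_real_derivative - z * std_normal_density z) (at z)"
      proof -
        have "((\<lambda>z. c * exp (- z\<^sup>2 / 2)) has_real_derivative - z * (c * exp (- z\<^sup>2 / 2))) (at z)" for c
          by (auto intro!: derivative_eq_intros)
        then show ?thesis unfolding std_normal_density_def[abs_def] .
      qed
      have "\<bar>z\<bar> powr p = z * \<bar>z\<bar> powr (p - 2) * z"
      proof (cases "z = 0")
        case False
        then show ?thesis using powr_add[of "\<bar>z\<bar>" "p - 2" 2] by (simp add: power2_eq_square mult_ac)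
      qed auto
      then show ?thesis
        unfolding has_real_derivative_iff_has_vector_derivative[symmetric] F_def[abs_def] f_def
        using DERIV_mult[OF 1 2] by (simp add: algebra_simps)
    qed
    have "continuous_on UNIV f"
      unfolding f_def using p by (intro continuous_on_diff continuous_on_mult_left continuous_abs_powr) auto
    moreover have "continuous_on UNIV std_normal_density"
      unfolding std_normal_density_def[abs_def] by (intro continuous_intros) auto
    ultimately show "isCont (\<lambda>z. std_normal_density z *\<^sub>R f z) z" for z
      by (intro continuous_intros) (auto simp: continuous_on_eq_continuous_at)
    show "((F \<circ> real_of_ereal) \<longlongrightarrow> 0) (at_right (-\<infinity>))" "((F \<circ> real_of_ereal) \<longlongrightarrow> 0) (at_left \<infinity>)"
      using lim lim' by (simp_all add: ereal_tendsto_simps)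
  qed (use fint' in \<open>auto simp: set_integrable_def ein\<close>)
  then have "(\<integral>z. std_normal_density z *\<^sub>R f z \<partial>lborel) = 0"
    by (simp add: interval_lebesgue_integral_def set_lebesgue_integral_def ein)
  then have "(\<integral>z. f z \<partial>std_normal_distribution) = 0"
    by (subst integral_density) auto
  then show ?thesis using int by (simp add: f_def gauss_moment_def)
qed

section \<open>Characteristic functions\<close>

lemma char_expD: "(\<integral>u. exp (\<i> * of_real (s * u)) \<partial>expD) = 1 / (1 - \<i> * of_real s)"
proof -
  let ?c = "\<i> * of_real s - 1"
  have c: "?c \<noteq> 0" by (simp add: complex_eq_iff)
  have m[measurable]: "(\<lambda>u. exp (\<i> * complex_of_real (s * u))) \<in> borel_measurable borel"
    by (intro borel_measurable_continuous_onI continuous_intros)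
  have "integrable expD (\<lambda>u. exp (\<i> * complex_of_real (s * u)))"
    by (rule expD.integrable_const_bound[of _ 1]) auto
  then have int: "set_integrable lborel (einterval 0 \<infinity>) (\<lambda>u. exp (- u) *\<^sub>R exp (\<i> * complex_of_real (s * u)))"
    by (subst (asm) integral_expD(2)) auto
  have eq: "exp (- u) *\<^sub>R exp (\<i> * complex_of_real (s * u)) = exp (?c * of_real u)" for u :: real
    by (simp add: scaleR_conv_of_real exp_of_real[symmetric] mult_exp_exp algebra_simps)
  have "(LBINT u=0..\<infinity>. exp (- u) *\<^sub>R exp (\<i> * complex_of_real (s * u))) = 0 - 1 / ?c"
  proof (rule interval_integral_FTC_integrable[where F = "\<lambda>u. exp (?c * of_real u) / ?c"])
    show "((\<lambda>u. exp (?c * of_real u) / ?c) has_vector_derivative exp (- u) *\<^sub>R exp (\<i> * complex_of_real (s * u))) (at u)" for u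
      unfolding eq
    proof (rule has_vector_derivative_real_field)
      show "((\<lambda>z. exp (?c * z) / ?c) has_field_derivative exp (?c * of_real u)) (at (of_real u))"
        using c by (auto intro!: derivative_eq_intros)
    qed
    show "isCont (\<lambda>u. exp (- u) *\<^sub>R exp (\<i> * complex_of_real (s * u))) u" for u
      by (intro continuous_intros)
    have "isCont (\<lambda>u::real. exp (?c * of_real u) / ?c) 0"
      using c by (intro continuous_intros) auto
    then have "((\<lambda>u::real. exp (?c * of_real u) / ?c) \<longlongrightarrow> 1 / ?c) (at_right 0)"
      by (auto simp: isCont_def intro: tendsto_within_subset)
    then show "(((\<lambda>u. exp (?c * of_real u) / ?c) \<circ> real_of_ereal) \<longlongrightarrow> 1 / ?c) (at_right 0)"
      unfolding zero_ereal_def by (simp add: ereal_tendsto_simps)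
    have "((\<lambda>u. exp (?c * of_real u) / ?c) \<longlongrightarrow> 0) at_top"
    proof (rule Lim_null_comparison)
      show "\<forall>\<^sub>F u::real in at_top. norm (exp (?c * of_real u) / ?c) \<le> exp (- u) / norm ?c"
        by (intro always_eventually allI) (simp add: norm_divide)
      show "((\<lambda>u. exp (- u) / norm ?c) \<longlongrightarrow> 0) at_top"
        by (rule tendsto_divide_zero) real_asymp
    qed
    then show "(((\<lambda>u. exp (?c * of_real u) / ?c) \<circ> real_of_ereal) \<longlongrightarrow> 0) (at_left \<infinity>)"
      by (simp add: ereal_tendsto_simps)
  qed (use int in auto)
  also have "0 - 1 / ?c = 1 / (1 - \<i> * of_real s)"
    by (metis diff_0 minus_diff_eq minus_divide_right)
  finally show ?thesis by (subst integral_expD(1)) auto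
qed

text \<open>The real part of the characteristic function is bounded by its modulus. This discards
  the phase, hence the signs of the \<open>y j\<close> and the mean, and leaves a product of the
  moduli of \<open>1 / (1 - i t y_j)\<close>.\<close>

lemma expPi_cos_le:
  assumes "finite (J :: nat set)"
  shows "(\<integral>\<omega>. cos (t * (\<Sum>j\<in>J. y j * \<omega> j)) \<partial>Pi\<^sub>M J (\<lambda>_. expD)) \<le> (\<Prod>j\<in>J. 1 / sqrt (1 + (t * y j)\<^sup>2))"
proof -
  have m[measurable]: "(\<lambda>u. exp (\<i> * complex_of_real (s * u))) \<in> borel_measurable borel" for s
    by (intro borel_measurable_continuous_onI continuous_intros)
  have int: "integrable expD (\<lambda>u. exp (\<i> * complex_of_real (s * u)))" for s
    by (rule expD.integrable_const_bound[of _ 1]) auto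
  let ?f = "\<lambda>\<omega>. \<Prod>j\<in>J. exp (\<i> * complex_of_real (t * y j * \<omega> j))"
  have f: "?f \<omega> = cis (t * (\<Sum>j\<in>J. y j * \<omega> j))" for \<omega>
    using assms by (simp add: exp_sum[symmetric] cis_conv_exp sum_distrib_left mult_ac)
  have "integrable (Pi\<^sub>M J (\<lambda>_. expD)) ?f"
    by (rule expPi.product_integrable_prod[OF assms, of "\<lambda>j u. exp (\<i> * complex_of_real (t * y j * u))"]) (rule int)
  then have "(\<integral>\<omega>. Re (?f \<omega>) \<partial>Pi\<^sub>M J (\<lambda>_. expD)) = Re (\<integral>\<omega>. ?f \<omega> \<partial>Pi\<^sub>M J (\<lambda>_. expD))"
    by (rule integral_bounded_linear[OF bounded_linear_Re])
  also have "\<dots> \<le> norm (\<integral>\<omega>. ?f \<omega> \<partial>Pi\<^sub>M J (\<lambda>_. expD))" by (rule complex_Re_le_cmod)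
  also have "(\<integral>\<omega>. ?f \<omega> \<partial>Pi\<^sub>M J (\<lambda>_. expD)) = (\<Prod>j\<in>J. 1 / (1 - \<i> * of_real (t * y j)))"
    by (subst expPi.product_integral_prod[OF assms, of "\<lambda>j u. exp (\<i> * complex_of_real (t * y j * u))"])
      (rule int, simp only: char_expD)
  also have "norm \<dots> = (\<Prod>j\<in>J. 1 / sqrt (1 + (t * y j)\<^sup>2))"
  proof -
    have "cmod (1 - \<i> * of_real u) = sqrt (1 + u\<^sup>2)" for u by (simp add: cmod_def)
    then show ?thesis by (simp only: prod_norm[symmetric] norm_divide norm_one)
  qed
  finally show ?thesis by (simp only: f cis.simps)
qed

text \<open>By concavity, \<open>(1 + a t\<^sup>2) powr (y\<^sub>j\<^sup>2 / a) \<le> 1 + t\<^sup>2 y\<^sub>j\<^sup>2\<close>.\<close>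
lemma prod_sqrt_le:
  assumes J: "finite J" and a: "a > 0" and y: "\<And>j. j \<in> J \<Longrightarrow> (y j)\<^sup>2 \<le> a" "1 + a \<le> (\<Sum>j\<in>J. (y j)\<^sup>2)"
  shows "(\<Prod>j\<in>J. 1 / sqrt (1 + (t * y j)\<^sup>2)) \<le> 1 / (1 + a * t\<^sup>2) powr ((1 / a + 1) / 2)"
proof -
  define b where "b = 1 + a * t\<^sup>2"
  have b: "b \<ge> 1" using a by (simp add: b_def)
  have "(\<Prod>j\<in>J. 1 / sqrt (1 + (t * y j)\<^sup>2)) \<le> (\<Prod>j\<in>J. b powr (- ((y j)\<^sup>2 / (2 * a))))"
  proof (intro prod_mono conjI)
    fix j assume j: "j \<in> J"
    have "b powr ((y j)\<^sup>2 / a) \<le> 1 + (y j)\<^sup>2 / a * (b - 1)"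
      by (rule powr_le_tangent) (use a b y(1)[OF j] in auto)
    also have "\<dots> = 1 + (t * y j)\<^sup>2" using a by (simp add: b_def power_mult_distrib)
    finally have "sqrt (b powr ((y j)\<^sup>2 / a)) \<le> sqrt (1 + (t * y j)\<^sup>2)" by simp
    then have "b powr ((y j)\<^sup>2 / (2 * a)) \<le> sqrt (1 + (t * y j)\<^sup>2)"
      using b by (simp add: powr_half_sqrt[symmetric] powr_powr mult.commute)
    then show "1 / sqrt (1 + (t * y j)\<^sup>2) \<le> b powr (- ((y j)\<^sup>2 / (2 * a)))"
      using b unfolding powr_minus_divide by (intro divide_left_mono) (auto intro!: mult_pos_pos add_pos_nonneg)
  qed auto
  also have "\<dots> = b powr (\<Sum>j\<in>J. - ((y j)\<^sup>2 / (2 * a)))"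
    using b J by (simp add: powr_sum)
  \<comment> \<open>The surplus in the sum of squares enters here: the total exponent is at least
    \<open>(1 + a) / (2 * a)\<close>.\<close>
  also have "\<dots> \<le> b powr (- ((1 / a + 1) / 2))"
  proof (rule powr_mono)
    have "(1 / a + 1) / 2 = (1 + a) / (2 * a)" using a by (simp add: field_simps)
    also have "\<dots> \<le> (\<Sum>j\<in>J. (y j)\<^sup>2) / (2 * a)" using a y(2) by (intro divide_right_mono) auto
    finally show "(\<Sum>j\<in>J. - ((y j)\<^sup>2 / (2 * a))) \<le> - ((1 / a + 1) / 2)"
      by (simp add: sum_negf sum_divide_distrib)
  qed (use b in auto)
  finally show ?thesis by (simp add: b_def powr_minus_divide)
qed

lemma std_normal_cos: "(\<integral>z. cos (t * z) \<partial>std_normal_distribution) = exp (- t\<^sup>2 / 2)"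
proof -
  have m[measurable]: "(\<lambda>z. cis (t * z)) \<in> borel_measurable borel"
    by (intro borel_measurable_continuous_onI continuous_intros)
  have "integrable std_normal_distribution (\<lambda>z. cis (t * z))"
    by (rule std_normal.integrable_const_bound[of _ 1]) auto
  then have "(\<integral>z. Re (cis (t * z)) \<partial>std_normal_distribution) = Re (\<integral>z. cis (t * z) \<partial>std_normal_distribution)"
    by (rule integral_bounded_linear[OF bounded_linear_Re])
  also have "(\<integral>z. cis (t * z) \<partial>std_normal_distribution) = exp (- t\<^sup>2 / 2)"
    using fun_cong[OF char_std_normal_distribution, of t] by (simp add: char_def cis_conv_exp)
  finally show ?thesis by simp
qed

text \<open>Only the real part of the characteristic function enters, through \<open>1 - Re\<close>;
  a pointwise upper bound on it therefore bounds the \<open>q\<close>-th absolute moment from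
  below.\<close>

lemma powr_transform_abs:
  assumes "prob_space M" and [measurable]: "Z \<in> borel_measurable M" and int: "integrable M (\<lambda>\<omega>. \<bar>Z \<omega>\<bar> powr q)" and q: "q > 0"
  shows "powr_transform q (\<lambda>t. 1 - (\<integral>\<omega>. cos (t * Z \<omega>) \<partial>M))
    = ennreal (\<integral>\<omega>. \<bar>Z \<omega>\<bar> powr q \<partial>M) * powr_transform q (\<lambda>t. 1 - cos t)"
proof -
  interpret M: prob_space M by fact
  have "powr_transform q (\<lambda>t. \<integral>\<omega>. 1 - cos (t * \<bar>Z \<omega>\<bar>) \<partial>M)
    = (\<integral>\<^sup>+\<omega>. ennreal (\<bar>Z \<omega>\<bar> powr q) \<partial>M) * powr_transform q (\<lambda>t. 1 - cos t)"
    by (rule powr_transform_mixture[OF assms(1), where B = 2])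
      (use q in \<open>auto simp: diff_le_eq intro: order_trans[OF _ cos_ge_minus_one[THEN add_left_mono]]\<close>)
  also have "(\<integral>\<^sup>+\<omega>. ennreal (\<bar>Z \<omega>\<bar> powr q) \<partial>M) = ennreal (\<integral>\<omega>. \<bar>Z \<omega>\<bar> powr q \<partial>M)"
    by (rule nn_integral_eq_integral[OF int]) auto
  also have "(\<lambda>t. \<integral>\<omega>. 1 - cos (t * \<bar>Z \<omega>\<bar>) \<partial>M) = (\<lambda>t. 1 - (\<integral>\<omega>. cos (t * Z \<omega>) \<partial>M))"
  proof
    fix t
    have "cos (t * \<bar>Z \<omega>\<bar>) = cos (t * Z \<omega>)" for \<omega> by (cases "Z \<omega> \<ge> 0") auto
    moreover have "integrable M (\<lambda>\<omega>. cos (t * Z \<omega>))" by (rule M.integrable_const_bound[of _ 1]) auto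
    ultimately show "(\<integral>\<omega>. 1 - cos (t * \<bar>Z \<omega>\<bar>) \<partial>M) = 1 - (\<integral>\<omega>. cos (t * Z \<omega>) \<partial>M)"
      by (simp add: M.prob_space)
  qed
  finally show ?thesis .
qed

section \<open>Comparison with a Gamma mixture of Gaussians\<close>

definition gamma_law :: "real \<Rightarrow> real measure" where
  "gamma_law k = density lborel (\<lambda>u. ennreal (u powr (k - 1) * exp (- u) / Gamma k) * indicator {0<..} u)"

text \<open>One formula for two uses: \<open>s = 0\<close> gives the Laplace transform, and
  \<open>c = 0\<close> gives the moment \<open>Gamma (k + s) / Gamma k\<close>.\<close>

lemma gamma_law_powr_exp:
  assumes k: "k > 0" and s: "s \<ge> 0" and c: "c \<ge> 0"
  shows "(\<integral>\<^sup>+u. ennreal (\<bar>u\<bar> powr s * exp (- (c * \<bar>u\<bar>))) \<partial>gamma_law k) = ennreal (Gamma (k + s) / (Gamma k * (1 + c) powr (k + s)))"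
proof -
  have G: "Gamma k > 0" using k by (rule Gamma_real_pos)
  have "(\<integral>\<^sup>+u. ennreal (\<bar>u\<bar> powr s * exp (- (c * \<bar>u\<bar>))) \<partial>gamma_law k)
      = (\<integral>\<^sup>+u. ennreal (1 / Gamma k) * (ennreal (u powr ((k + s) - 1) * exp (- ((1 + c) * u))) * indicator {0<..} u) \<partial>lborel)"
    unfolding gamma_law_def
  proof (subst nn_integral_density, measurable, intro nn_integral_cong)
    fix u :: real
    have "u powr (k - 1) * exp (- u) / Gamma k * (u powr s * exp (- (c * u))) = 1 / Gamma k * (u powr ((k + s) - 1) * exp (- ((1 + c) * u)))" if "u > 0"
    proof -
      have "u powr (k - 1) * u powr s = u powr ((k + s) - 1)" unfolding powr_add[symmetric] by (simp add: algebra_simps)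
      moreover have "exp (- u) * exp (- (c * u)) = exp (- ((1 + c) * u))" unfolding mult_exp_exp by (simp add: algebra_simps)
      ultimately show ?thesis by (metis (no_types, lifting) mult.assoc mult.left_commute times_divide_eq_left times_divide_eq_right mult_1)
    qed
    then show "ennreal (u powr (k - 1) * exp (- u) / Gamma k) * indicator {0<..} u * ennreal (\<bar>u\<bar> powr s * exp (- (c * \<bar>u\<bar>)))
        = ennreal (1 / Gamma k) * (ennreal (u powr ((k + s) - 1) * exp (- ((1 + c) * u))) * indicator {0<..} u)"
      using G by (cases "u > 0") (auto simp: ennreal_mult[symmetric])
  qed
  also have "\<dots> = ennreal (1 / Gamma k) * ennreal (Gamma (k + s) / (1 + c) powr (k + s))"
    using nn_integral_Gamma[of "k + s" "1 + c"] k s c by (simp add: nn_integral_cmult)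
  also have "\<dots> = ennreal (Gamma (k + s) / (Gamma k * (1 + c) powr (k + s)))"
    using G Gamma_real_pos[of "k + s"] k s by (subst ennreal_mult[symmetric]) auto
  finally show ?thesis .
qed

lemma gamma_law_exp:
  assumes k: "k > 0" and c: "c \<ge> 0"
  shows "prob_space (gamma_law k)" "(\<integral>u. exp (- (c * \<bar>u\<bar>)) \<partial>gamma_law k) = 1 / (1 + c) powr k"
proof -
  have G: "Gamma k > 0" using k by (rule Gamma_real_pos)
  have e: "(\<integral>\<^sup>+u. ennreal (exp (- (c * \<bar>u\<bar>))) \<partial>gamma_law k) = ennreal (1 / (1 + c) powr k)" if "c \<ge> 0" for c
  proof -
    \<comment> \<open>Since \<open>0 powr 0 = 0\<close>, the two integrands differ at
      \<open>u = 0\<close>; the density vanishes there.\<close>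
    have "(\<integral>\<^sup>+u. ennreal (exp (- (c * \<bar>u\<bar>))) \<partial>gamma_law k) = (\<integral>\<^sup>+u. ennreal (\<bar>u\<bar> powr 0 * exp (- (c * \<bar>u\<bar>))) \<partial>gamma_law k)"
      unfolding gamma_law_def
      by (subst (1 2) nn_integral_density) (auto intro!: nn_integral_cong simp: indicator_def)
    also have "\<dots> = ennreal (1 / (1 + c) powr k)"
      using gamma_law_powr_exp[OF k order_refl that] G by simp
    finally show ?thesis .
  qed
  have "emeasure (gamma_law k) (space (gamma_law k)) = (\<integral>\<^sup>+u. 1 \<partial>gamma_law k)"
    by (simp add: nn_integral_const)
  also have "\<dots> = 1" using e[of 0] by simp
  finally show "prob_space (gamma_law k)" by (rule prob_spaceI)
  show "(\<integral>u. exp (- (c * \<bar>u\<bar>)) \<partial>gamma_law k) = 1 / (1 + c) powr k"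
    using c by (subst integral_eq_nn_integral) (auto simp: e gamma_law_def[symmetric], simp_all add: gamma_law_def)
qed

text \<open>The product bound \<open>(1 + a t^2)^(-k)\<close> with \<open>k = (1/a + 1) / 2\<close>
  is the characteristic function of \<open>sqrt (2 a U) G\<close>, where \<open>U\<close> is Gamma
  distributed with shape \<open>k\<close> and independent of \<open>G\<close>. So the moment on the
  right is at least \<open>g_q (2a)^(q/2) Gamma (k + q/2) / Gamma k\<close>. By the Gamma
  inequality, which needs \<open>k >= 1\<close> and hence \<open>a <= 1\<close>, this is at least
  \<open>g_q (2a (k - 1/2))^(q/2) = g_q\<close>.\<close>

lemma esum_powr_ge_gauss_moment_small:
  assumes q: "0 < q" "q < 2" and J: "finite J" and a: "0 < a" "a \<le> 1"
    and y: "\<And>j. j \<in> J \<Longrightarrow> (y j)\<^sup>2 \<le> a" "1 + a \<le> (\<Sum>j\<in>J. (y j)\<^sup>2)"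
  shows "gauss_moment q \<le> esum J y (\<lambda>z. \<bar>z\<bar> powr q)"
proof -
  define k where "k = (1 / a + 1) / 2"
  define s where "s = q / 2"
  \<comment> \<open>The random standard deviation of the mixture; the factor 2 cancels the 1/2 in
    \<open>exp (- t^2 / 2)\<close>.\<close>
  define Z where "Z u = sqrt (2 * a * \<bar>u\<bar>)" for u :: real
  define h where "h t = 1 - exp (- t\<^sup>2 / 2)" for t :: real
  have k: "k \<ge> 1" "2 * a * (k - 1/2) = 1" using a by (auto simp: k_def field_simps)
  have k0: "k > 0" using k by simp
  have s: "0 < s" "s < 1" using q by (auto simp: s_def)
  interpret G: prob_space "gamma_law k" by (rule gamma_law_exp[OF k0 order_refl])
  interpret P: prob_space "Pi\<^sub>M J (\<lambda>_. expD)" by (rule prob_space_PiM) (rule expD.prob_space_axioms)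
  let ?C = "powr_transform q (\<lambda>t. 1 - cos t)"
  have Zm[measurable]: "Z \<in> borel_measurable (gamma_law k)"
    unfolding gamma_law_def Z_def[abs_def] by measurable
  have hm[measurable]: "h \<in> borel_measurable borel" unfolding h_def[abs_def] by measurable
  have hZ: "h (t * Z u) = 1 - exp (- (a * t\<^sup>2 * \<bar>u\<bar>))" for t u
    using a by (simp add: h_def Z_def power_mult_distrib mult_ac)
  have "powr_transform q (\<lambda>t. 1 - (\<integral>z. cos (t * z) \<partial>std_normal_distribution))
    = ennreal (\<integral>z. \<bar>z\<bar> powr q \<partial>std_normal_distribution) * ?C"
    by (rule powr_transform_abs) (use q gauss_moment_integrable std_normal.prob_space_axioms in auto)
  then have "ennreal (gauss_moment q) * ?C = powr_transform q h"
    by (simp add: std_normal_cos gauss_moment_def h_def[abs_def])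
  also have "\<dots> = 1 * powr_transform q h" by simp
  also have "\<dots> \<le> (\<integral>\<^sup>+u. ennreal (Z u powr q) \<partial>gamma_law k) * powr_transform q h"
  proof (rule mult_right_mono)
    have G: "Gamma k > 0" using k0 by (rule Gamma_real_pos)
    have "1 = (2 * a) powr s * (k - 1/2) powr s"
      using k a by (simp add: powr_mult[symmetric])
    also have "\<dots> \<le> (2 * a) powr s * (Gamma (k + s) / Gamma k)"
      using Gamma_shift_ge_half[OF k(1) s] G by (intro mult_left_mono) (auto simp: field_simps)
    finally have 1: "1 \<le> (2 * a) powr s * (Gamma (k + s) / Gamma k)" .
    have "(\<integral>\<^sup>+u. ennreal (Z u powr q) \<partial>gamma_law k) = (\<integral>\<^sup>+u. ennreal ((2 * a) powr s) * ennreal (\<bar>u\<bar> powr s * exp (- (0 * \<bar>u\<bar>))) \<partial>gamma_law k)"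
    proof (intro nn_integral_cong)
      fix u :: real
      have "Z u powr q = (2 * a) powr s * \<bar>u\<bar> powr s"
        using a by (simp add: Z_def powr_half_sqrt[symmetric] powr_powr powr_mult s_def)
      then show "ennreal (Z u powr q) = ennreal ((2 * a) powr s) * ennreal (\<bar>u\<bar> powr s * exp (- (0 * \<bar>u\<bar>)))"
        by (simp add: ennreal_mult)
    qed
    also have "\<dots> = ennreal ((2 * a) powr s) * (\<integral>\<^sup>+u. ennreal (\<bar>u\<bar> powr s * exp (- (0 * \<bar>u\<bar>))) \<partial>gamma_law k)"
      by (rule nn_integral_cmult) (simp add: gamma_law_def)
    also have "\<dots> = ennreal ((2 * a) powr s) * ennreal (Gamma (k + s) / Gamma k)"
      by (subst gamma_law_powr_exp) (use k0 s in auto)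
    also have "\<dots> = ennreal ((2 * a) powr s * (Gamma (k + s) / Gamma k))"
      by (rule ennreal_mult'[symmetric]) simp
    also have "\<dots> \<ge> 1" using ennreal_leI[OF 1] by simp
    finally show "1 \<le> (\<integral>\<^sup>+u. ennreal (Z u powr q) \<partial>gamma_law k)" .
  qed simp
  also have "\<dots> = powr_transform q (\<lambda>t. \<integral>u. h (t * Z u) \<partial>gamma_law k)"
  proof (rule powr_transform_mixture[symmetric, where B = 1])
    show "0 \<le> Z u" for u using a by (simp add: Z_def)
  qed (use q in \<open>auto simp: h_def intro: G.prob_space_axioms\<close>)
  also have "\<dots> \<le> powr_transform q (\<lambda>t. 1 - (\<integral>\<omega>. cos (t * (\<Sum>j\<in>J. y j * \<omega> j)) \<partial>Pi\<^sub>M J (\<lambda>_. expD)))"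
  proof (rule powr_transform_mono)
    fix t :: real
    have "integrable (gamma_law k) (\<lambda>u. exp (- (a * t\<^sup>2 * \<bar>u\<bar>)))"
      by (rule G.integrable_const_bound[of _ 1]) (use a in \<open>auto simp: gamma_law_def\<close>)
    then have "(\<integral>u. h (t * Z u) \<partial>gamma_law k) = 1 - 1 / (1 + a * t\<^sup>2) powr k"
      using gamma_law_exp(2)[OF k0, of "a * t\<^sup>2"] a by (simp add: hZ G.prob_space)
    also have "\<dots> \<le> 1 - (\<integral>\<omega>. cos (t * (\<Sum>j\<in>J. y j * \<omega> j)) \<partial>Pi\<^sub>M J (\<lambda>_. expD))"
      using expPi_cos_le[OF J, of t y] prod_sqrt_le[OF J a(1) y, of t] by (simp add: k_def)
    finally show "(\<integral>u. h (t * Z u) \<partial>gamma_law k) \<le> 1 - (\<integral>\<omega>. cos (t * (\<Sum>j\<in>J. y j * \<omega> j)) \<partial>Pi\<^sub>M J (\<lambda>_. expD))" .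
  qed
  also have "\<dots> = ennreal (esum J y (\<lambda>z. \<bar>z\<bar> powr q)) * ?C"
    unfolding esum_def
    by (rule powr_transform_abs[OF P.prob_space_axioms _ esum_integrable[OF continuous_abs_powr poly_growth_powr J] q(1)])
      (use q in auto)
  finally have "?C * ennreal (gauss_moment q) \<le> ?C * ennreal (esum J y (\<lambda>z. \<bar>z\<bar> powr q))"
    by (simp only: mult.commute[of ?C])
  moreover have "?C \<noteq> 0" "?C \<noteq> \<top>" using powr_transform_one_minus_cos[OF q] by simp_all
  ultimately have "ennreal (gauss_moment q) \<le> ennreal (esum J y (\<lambda>z. \<bar>z\<bar> powr q))"
    using ennreal_mult_le_mult_iff[of ?C] by blast
  then show ?thesis using esum_powr_nonneg by simp
qed

section \<open>The moment comparison\<close>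

lemma esum_powr_ge_gauss_moment:
  assumes "p \<ge> 2" "finite I"
  shows "gauss_moment p * (\<Sum>i\<in>I. (x i)\<^sup>2) powr (p / 2) \<le> esum I x (\<lambda>z. \<bar>z\<bar> powr p)"
  using assms
\<comment> \<open>The exponent drops by 2 while the index set and the vector grow, so the integer
  part of \<open>p\<close> is the measure and all three are generalised.\<close>
proof (induction "nat \<lfloor>p\<rfloor>" arbitrary: p I x rule: less_induct)
  case less
  note I = \<open>finite I\<close>
  consider "I = {}" | "p = 2" | "p > 2" "I \<noteq> {}" using less.prems by linarith
  then show ?case
  proof cases
    case 1
    then show ?thesis by (simp add: esum_powr_nonneg)
  next
    case 2
    have "(\<lambda>z::real. \<bar>z\<bar> powr p) = (\<lambda>z. z\<^sup>2)" using 2 by (auto simp: fun_eq_iff)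
    \<comment> \<open>The second moment exceeds the sum of squares, which is the variance, by the
      square of the mean.\<close>
    then show ?thesis using 2 by (simp add: gauss_moment_2 esum_square[OF I] sum_nonneg)
  next
    case 3
    have p: "p > 2" by fact
    have reg: "continuous_on UNIV (\<lambda>z::real. \<bar>z\<bar> powr p)" "poly_growth (\<lambda>z. \<bar>z\<bar> powr p)"
      using p by (auto intro: continuous_abs_powr poly_growth_powr)
    obtain x0 where x0: "(\<Sum>i\<in>I. (x0 i)\<^sup>2) = 1"
      and min: "\<And>y. (\<Sum>i\<in>I. (y i)\<^sup>2) = 1 \<Longrightarrow> esum I x0 (\<lambda>z. \<bar>z\<bar> powr p) \<le> esum I y (\<lambda>z. \<bar>z\<bar> powr p)"
      using esum_attains_inf[OF reg I 3(2)] by blast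
    obtain k where k: "k \<notin> I" using I by (meson ex_new_if_finite infinite_UNIV_nat)
    obtain l where l: "l \<notin> insert k I" using I by (meson ex_new_if_finite finite_insert infinite_UNIV_nat)
    have rec: "gauss_moment p = (p - 1) * gauss_moment (p - 2)" by (rule gauss_moment_rec[OF p])
    let ?J = "insert l (insert k I)"
    have J: "finite ?J" using I by simp
    \<comment> \<open>The statement being proved starts at exponent 2, so \<open>p - 2\<close> is
      within its reach only from \<open>p = 4\<close> on.\<close>
    have IH: "gauss_moment (p - 2) * (\<Sum>i\<in>?J. (y i)\<^sup>2) powr ((p - 2) / 2) \<le> esum ?J y (\<lambda>z. \<bar>z\<bar> powr (p - 2))"
      if "p \<ge> 4" for y
      using less.hyps[of "p - 2" ?J y] that J by (simp add: nat_less_iff)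
    have "gauss_moment p \<le> esum I x0 (\<lambda>z. \<bar>z\<bar> powr p)"
    proof -
      have "(\<lambda>i. (x0 i)\<^sup>2) ` I \<noteq> {}" "finite ((\<lambda>i. (x0 i)\<^sup>2) ` I)" using 3 I by auto
      \<comment> \<open>Maximality of \<open>|x0 i|\<close> makes every squared coordinate of the
        enlarged vector at most \<open>a\<close>, while the repetition of \<open>x0 i\<close> lifts
        the sum of squares to at least \<open>1 + a\<close>; these are the hypotheses of the
        estimate for orders below 2.\<close>
      from Max_in[OF this(2,1)] obtain i where i: "i \<in> I" "(x0 i)\<^sup>2 = Max ((\<lambda>i. (x0 i)\<^sup>2) ` I)" by auto
      have i_max: "(x0 j)\<^sup>2 \<le> (x0 i)\<^sup>2" if "j \<in> I" for j
        unfolding i(2) using I that by simp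
      define a where "a = (x0 i)\<^sup>2"
      have a: "0 < a" "a \<le> 1"
      proof -
        show "a \<le> 1" unfolding a_def using member_le_sum[of i I "\<lambda>i. (x0 i)\<^sup>2"] i I x0 by simp
        show "0 < a"
        proof (rule ccontr)
          assume "\<not> 0 < a"
          then have "x0 j = 0" if "j \<in> I" for j using i_max[OF that] by (simp add: a_def)
          then show False using x0 by simp
        qed
      qed
      show ?thesis
      proof (cases "\<exists>j\<in>I. x0 j \<noteq> x0 i")
        case True
        then obtain j where j: "j \<in> I" "x0 i \<noteq> x0 j" by metis
        define y where "y = fun_upd (fun_upd x0 k (x0 i)) l (x0 j)"
        have m: "esum I x0 (\<lambda>z. \<bar>z\<bar> powr p) = (p - 1) * esum ?J y (\<lambda>z. \<bar>z\<bar> powr (p - 2))"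
          unfolding y_def by (rule esum_minimum_distinct[OF I i(1) j(1) p x0 min j(2) k l])
        have "(\<Sum>n\<in>I. (y n)\<^sup>2) = (\<Sum>n\<in>I. (x0 n)\<^sup>2)"
          by (intro sum.cong) (use k l in \<open>auto simp: y_def\<close>)
        then have sum: "(\<Sum>n\<in>?J. (y n)\<^sup>2) = 1 + a + (x0 j)\<^sup>2"
          using I k l x0 by (simp add: y_def a_def)
        have "gauss_moment (p - 2) \<le> esum ?J y (\<lambda>z. \<bar>z\<bar> powr (p - 2))"
        proof (cases "p < 4")
          case True
          show ?thesis
          proof (rule esum_powr_ge_gauss_moment_small[OF _ _ J a])
            show "(y n)\<^sup>2 \<le> a" if "n \<in> ?J" for n
              using that i_max i(1) j(1) by (auto simp: y_def a_def)
            show "1 + a \<le> (\<Sum>n\<in>?J. (y n)\<^sup>2)" unfolding sum by simp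
          qed (use True p in auto)
        next
          case False
          have "1 \<le> (1 + a + (x0 j)\<^sup>2) powr ((p - 2) / 2)"
            by (rule ge_one_powr_ge_zero) (use a p in auto)
          from mult_left_mono[OF this gauss_moment_nonneg[of "p - 2"]] show ?thesis
            using IH[of y] False unfolding sum by simp
        qed
        then show ?thesis unfolding m rec using p by simp
      next
        case False
        then have eq: "\<And>j. j \<in> I \<Longrightarrow> x0 j = x0 i" by blast
        define n where "n = card I"
        have n: "n \<ge> 1" using I 3 by (simp add: n_def Suc_le_eq card_gt_0_iff)
        have na: "real n * a = 1"
          using unit_vector_constant(2)[OF I x0 eq] by (simp add: n_def a_def)
        show ?thesis
        proof (cases "p < 4")
          case True
          \<comment> \<open>All coordinates being equal, the squared mean is \<open>n\<close> and
            the second moment \<open>n + 1\<close>. The tangent bound for \<open>|z|^p\<close> in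
            terms of \<open>z^2\<close> then gives a moment of at least
            \<open>1 + p * n / 2 >= 1 + p / 2\<close>. This exceeds \<open>p - 1\<close> for
            \<open>p < 4\<close>, and the Gaussian moment is at most \<open>p - 1\<close>.\<close>
          have "(\<Sum>j\<in>I. x0 j) = n * x0 i" using eq by (simp add: n_def)
          then have "(\<Sum>j\<in>I. x0 j)\<^sup>2 = n * (n * a)" by (simp add: a_def power2_eq_square mult_ac)
          then have sq: "esum I x0 (\<lambda>z. z\<^sup>2) = n + 1" by (simp add: esum_square[OF I] x0 na)
          have int2: "integrable (Pi\<^sub>M I (\<lambda>_. expD)) (\<lambda>\<omega>. (\<Sum>i\<in>I. x0 i * \<omega> i)\<^sup>2)"
            using esum_integrable[OF _ poly_growth_mult[OF poly_growth_id poly_growth_id] I]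
            by (simp add: power2_eq_square continuous_on_mult continuous_on_id)
          interpret P: prob_space "Pi\<^sub>M I (\<lambda>_. expD)" by (rule prob_space_PiM) (rule expD.prob_space_axioms)
          have "1 + p / 2 * (esum I x0 (\<lambda>z. z\<^sup>2) - 1)
              = (\<integral>\<omega>. 1 + p / 2 * ((\<Sum>i\<in>I. x0 i * \<omega> i)\<^sup>2 - 1) \<partial>Pi\<^sub>M I (\<lambda>_. expD))"
            using int2 P.prob_space unfolding esum_def by simp
          also have "\<dots> \<le> esum I x0 (\<lambda>z. \<bar>z\<bar> powr p)"
            unfolding esum_def
          proof (rule integral_mono)
            show "integrable (Pi\<^sub>M I (\<lambda>_. expD)) (\<lambda>\<omega>. 1 + p / 2 * ((\<Sum>i\<in>I. x0 i * \<omega> i)\<^sup>2 - 1))"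
              using int2 by simp
            show "1 + p / 2 * ((\<Sum>i\<in>I. x0 i * \<omega> i)\<^sup>2 - 1) \<le> \<bar>\<Sum>i\<in>I. x0 i * \<omega> i\<bar> powr p" for \<omega>
            proof -
              let ?z = "\<Sum>i\<in>I. x0 i * \<omega> i"
              have "\<bar>?z\<bar> powr p = (?z\<^sup>2) powr (p / 2)"
                using powr_powr[of "\<bar>?z\<bar>" 2 "p / 2"] by (cases "?z = 0") auto
              then show ?thesis using powr_ge_tangent[of "?z\<^sup>2" "p / 2"] p by simp
            qed
          qed (rule esum_integrable[OF reg I])
          finally have 1: "1 + p / 2 * real n \<le> esum I x0 (\<lambda>z. \<bar>z\<bar> powr p)" unfolding sq by simp
          have "gauss_moment p \<le> (p - 1) * 1"
            unfolding rec using gauss_moment_le_1[of "p - 2"] p True by (intro mult_left_mono) auto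
          also have "\<dots> \<le> 1 + p / 2 * 1" using True by simp
          also have "\<dots> \<le> 1 + p / 2 * real n" using n p by (intro add_left_mono mult_left_mono) auto
          also note 1
          finally show ?thesis .
        next
          case False
          \<comment> \<open>The prefactor is \<open>1 + n\<close> where \<open>p - 1\<close> is
            wanted. Two further coordinates of square \<open>1 / n\<close> raise the sum of squares
            to \<open>1 + 2 / n\<close>, and by Bernoulli its power is at least
            \<open>1 + (p - 2) / n\<close>, which makes up the difference also for small
            \<open>n\<close>.\<close>
          have m: "esum I x0 (\<lambda>z. \<bar>z\<bar> powr p) = (1 + n) * esum ?J (\<lambda>_. x0 i) (\<lambda>z. \<bar>z\<bar> powr (p - 2))"
            unfolding n_def by (rule esum_minimum_equal[OF I i(1) p x0 min eq k l])
          have a_n: "a = 1 / n" using na n by (simp add: field_simps)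
          have sum: "(\<Sum>n\<in>?J. (x0 i)\<^sup>2) = 1 + 2 / n"
            using I k l n by (simp add: a_def[symmetric] n_def[symmetric] a_n field_simps)
          have "(1 + 2 / n) powr ((p - 2) / 2) \<ge> 1 + (p - 2) / 2 * (1 + 2 / real n - 1)"
            by (rule powr_ge_tangent) (use False in auto)
          moreover have "(p - 2) / 2 * (1 + 2 / real n - 1) = (p - 2) / n"
            using n by (simp add: field_simps)
          ultimately have t: "1 + (p - 2) / n \<le> (1 + 2 / n) powr ((p - 2) / 2)" by (simp only:)
          have "p - 1 \<le> (1 + real n) * (1 + (p - 2) / n)"
          proof -
            have "(1 + real n) * (1 + (p - 2) / n) = 1 + real n + (p - 2) / n + (p - 2)"
              using n by (simp add: field_simps)
            moreover have "(p - 2) / n \<ge> 0" using p by simp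
            ultimately show ?thesis by linarith
          qed
          also have "\<dots> \<le> (1 + real n) * (1 + 2 / n) powr ((p - 2) / 2)"
            using t by (intro mult_left_mono) auto
          finally have "(p - 1) * gauss_moment (p - 2) \<le> (1 + real n) * (1 + 2 / n) powr ((p - 2) / 2) * gauss_moment (p - 2)"
            by (rule mult_right_mono) (rule gauss_moment_nonneg)
          also have "\<dots> = (1 + real n) * (gauss_moment (p - 2) * (\<Sum>n\<in>?J. (x0 i)\<^sup>2) powr ((p - 2) / 2))"
            unfolding sum by simp
          also have "\<dots> \<le> (1 + real n) * esum ?J (\<lambda>_. x0 i) (\<lambda>z. \<bar>z\<bar> powr (p - 2))"
            using IH[of "\<lambda>_. x0 i"] False by (intro mult_left_mono) auto
          finally show ?thesis unfolding m rec by simp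
        qed
      qed
    qed
    then show ?thesis
      by (intro esum_powr_ge_of_unit[OF I]) (use min in \<open>blast intro: order_trans\<close>)
  qed
qed

section \<open>Transfer to arbitrary probability spaces\<close>

lemma expectation_eq_esum:
  assumes "prob_space M" and I: "finite I" "I \<noteq> {}"
    and indep: "prob_space.indep_vars M (\<lambda>_. borel) E I"
    and E: "\<And>j. j \<in> I \<Longrightarrow> distributed M lborel (E j) (exponential_density 1)"
    and f: "f \<in> borel_measurable borel"
  shows "(\<integral>\<omega>. f (\<Sum>j\<in>I. x j * E j \<omega>) \<partial>M) = esum I x f"
proof -
  interpret M: prob_space M by fact
  have m: "E j \<in> borel_measurable M" if "j \<in> I" for j
    using distributed_measurable[OF E[OF that]] by simp
  have d: "distr M borel (E j) = expD" if "j \<in> I" for j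
  proof -
    have "distr M borel (E j) = distr M lborel (E j)" by (rule distr_cong) auto
    then show ?thesis using distributed_distr_eq_density[OF E[OF that]] by simp
  qed
  have "distr M (Pi\<^sub>M I (\<lambda>_. borel)) (\<lambda>\<omega>. \<lambda>j\<in>I. E j \<omega>) = Pi\<^sub>M I (\<lambda>j. distr M borel (E j))"
    using M.indep_vars_iff_distr_eq_PiM'[of I E "\<lambda>_. borel"] I(2) m indep by simp
  also have "\<dots> = Pi\<^sub>M I (\<lambda>_. expD)" by (rule PiM_cong) (auto simp: d)
  finally have D: "Pi\<^sub>M I (\<lambda>_. expD) = distr M (Pi\<^sub>M I (\<lambda>_. borel)) (\<lambda>\<omega>. \<lambda>j\<in>I. E j \<omega>)" ..
  have "(\<lambda>\<omega>. \<lambda>j\<in>I. E j \<omega>) \<in> measurable M (Pi\<^sub>M I (\<lambda>_. borel))"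
    using m by (rule measurable_restrict)
  moreover have "(\<lambda>\<omega>. f (\<Sum>j\<in>I. x j * \<omega> j)) \<in> borel_measurable (Pi\<^sub>M I (\<lambda>_. borel :: real measure))"
    using f by measurable
  ultimately have "esum I x f = (\<integral>\<omega>. f (\<Sum>j\<in>I. x j * (\<lambda>j\<in>I. E j \<omega>) j) \<partial>M)"
    unfolding esum_def D by (rule integral_distr)
  also have "\<dots> = (\<integral>\<omega>. f (\<Sum>j\<in>I. x j * E j \<omega>) \<partial>M)" by (simp cong: sum.cong)
  finally show ?thesis ..
qed

lemma esum_variance:
  assumes I: "finite I"
  shows "esum I x (\<lambda>z. (z - (\<Sum>i\<in>I. x i))\<^sup>2) = (\<Sum>i\<in>I. (x i)\<^sup>2)"
proof -
  define c where "c = (\<Sum>i\<in>I. x i)"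
  interpret P: prob_space "Pi\<^sub>M I (\<lambda>_. expD)" by (rule prob_space_PiM) (rule expD.prob_space_axioms)
  have i1: "integrable (Pi\<^sub>M I (\<lambda>_. expD)) (\<lambda>\<omega>. \<Sum>i\<in>I. x i * \<omega> i)"
    by (rule esum_integrable[OF continuous_on_id poly_growth_id I])
  have i2: "integrable (Pi\<^sub>M I (\<lambda>_. expD)) (\<lambda>\<omega>. (\<Sum>i\<in>I. x i * \<omega> i)\<^sup>2)"
    using esum_integrable[OF _ poly_growth_mult[OF poly_growth_id poly_growth_id] I]
    by (simp add: power2_eq_square continuous_on_mult continuous_on_id)
  have "esum I x (\<lambda>z. (z - c)\<^sup>2) = (\<integral>\<omega>. (\<Sum>i\<in>I. x i * \<omega> i)\<^sup>2 - 2 * c * (\<Sum>i\<in>I. x i * \<omega> i) + c\<^sup>2 \<partial>Pi\<^sub>M I (\<lambda>_. expD))"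
    unfolding esum_def by (intro Bochner_Integration.integral_cong) (simp_all add: power2_eq_square algebra_simps)
  also have "\<dots> = esum I x (\<lambda>z. z\<^sup>2) - 2 * c * esum I x (\<lambda>z. z) + c\<^sup>2"
    unfolding esum_def using i1 i2 P.prob_space by simp
  also have "\<dots> = (\<Sum>i\<in>I. (x i)\<^sup>2)"
    unfolding esum_square[OF I] esum_id[OF I] c_def[symmetric] by (simp add: power2_eq_square)
  finally show ?thesis by (simp add: c_def)
qed

theorem theorem1:
  fixes M :: "'a measure" and N :: "'b measure"
    and p :: real and n :: nat and x :: "nat \<Rightarrow> real"
    and \<E> :: "nat \<Rightarrow> 'a \<Rightarrow> real" and X :: "'a \<Rightarrow> real" and G :: "'b \<Rightarrow> real"
  assumes "p \<ge> 2" and "n \<ge> 1"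
    and "prob_space M"
    and "prob_space.indep_vars M (\<lambda>_. borel) \<E> {1..n}"
    and "\<And>j. j \<in> {1..n} \<Longrightarrow> distributed M lborel (\<E> j) (exponential_density 1)"
    and "X = (\<lambda>\<omega>. \<Sum>j=1..n. x j * \<E> j \<omega>)"
    and "prob_space N"
    and "distributed N lborel G std_normal_density"
  shows "Lp_norm M p X \<ge> Lp_norm N p G * sqrt (prob_space.variance M X)"
proof -
  have I: "finite {1..n}" "{1..n} \<noteq> {}" using assms(2) by auto
  define \<sigma> where "\<sigma> = (\<Sum>i=1..n. (x i)\<^sup>2)"
  have \<sigma>: "\<sigma> \<ge> 0" unfolding \<sigma>_def by (simp add: sum_nonneg)
  note E = expectation_eq_esum[OF assms(3) I assms(4,5)]
  have EX: "(\<integral>\<omega>. X \<omega> \<partial>M) = (\<Sum>i=1..n. x i)"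
    using E[of "\<lambda>z. z" x] by (simp add: assms(6) esum_id)
  have var: "prob_space.variance M X = \<sigma>"
    unfolding EX using E[of "\<lambda>z. (z - (\<Sum>i=1..n. x i))\<^sup>2" x]
    by (simp add: assms(6) esum_variance \<sigma>_def)
  have "(\<lambda>z::real. \<bar>z\<bar> powr p) \<in> borel_measurable borel" by measurable
  from E[OF _ this, of x] have LX: "(\<integral>\<omega>. \<bar>X \<omega>\<bar> powr p \<partial>M) = esum {1..n} x (\<lambda>z. \<bar>z\<bar> powr p)"
    by (simp add: assms(6))
  have LG: "(\<integral>\<omega>. \<bar>G \<omega>\<bar> powr p \<partial>N) = gauss_moment p"
    unfolding gauss_moment_def distributed_distr_eq_density[OF assms(8), symmetric]
    by (subst integral_distr) (use distributed_measurable[OF assms(8)] in auto)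
  \<comment> \<open>Taking \<open>p\<close>-th roots turns the factor
    \<open>\<sigma> powr (p / 2)\<close> of the moment inequality into the standard
    deviation.\<close>
  have "gauss_moment p powr (1 / p) * sqrt \<sigma> = (gauss_moment p * \<sigma> powr (p / 2)) powr (1 / p)"
    using gauss_moment_nonneg[of p] \<sigma> assms(1) by (simp add: powr_mult powr_powr powr_half_sqrt)
  also have "\<dots> \<le> (esum {1..n} x (\<lambda>z. \<bar>z\<bar> powr p)) powr (1 / p)"
    unfolding \<sigma>_def using esum_powr_ge_gauss_moment[OF assms(1) I(1), of x] gauss_moment_nonneg[of p] assms(1)
    by (intro powr_mono2) auto
  finally show ?thesis by (simp add: Lp_norm_def LX LG var)
qed

end
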